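(* Let $S$ be a finite semigroup with commuting idempotents and $K$ a field. Define the linear map $\nu:KS\to KR(S)$ on $s\in S$ by \[\nu(s)=\sum_{t\in s^{\downarrow}}\lfloor t\rfloor .\] Then $\nu$ is a retraction (an algebra homomorphism restricting to the identity on $KR(S)\subseteq KS$) with nilpotent kernel. Hence $KS/\mathrm{Rad}(KS)=KR(S)/\mathrm{Rad}(KR(S))$ (identified via $\nu$). In particular, if the characteristic of $K$ is $0$ (or more generally if the characteristic of $K$ does not divide the order of any maximal subgroup of $S$), then $\ker\nu=\mathrm{Rad}(KS)$. In this case $\dim_K \mathrm{Rad}(KS)=|S\setminus R(S)|$ and a basis for $\mathrm{Rad}(KS)$ is given by the set $\{s-\nu(s)\mid s\in S\setminus R(S)\}$.
   Context: A semigroup has commuting idempotents if $ef=fe$ for all idempotents $e,f$. An element $s\in S$ is regular if there is $t\in S$ with $sts=s$ and $tst=t$; $R(S)$ is the set of regular elements. When $S$ is finite with commuting idempotents, such $t$ is unique (written $s^{-1}$) and $R(S)$ is a subsemigroup that is an inverse semigroup, containing all idempotents of $S$. Order $R(S)$ by $t\le s\iff t=es$ for some idempotent $e$, and let $\mu$ be the M\"obius function of $(R(S),\le)$. In the semigroup algebra $KR(S)$ (viewed as a subalgebra of $KS$) define, for $s\in R(S)$, $\lfloor s\rfloor=\sum_{t\in R(S),\,t\le s}\mu(t,s)\,t$. For $s\in S$ let $s^{\downarrow}=\{u\in R(S)\mid uu^{-1}s=u\}$. $\mathrm{Rad}(A)$ is the Jacobson radical of the finite-dimensional algebra $A$ (its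 largest nilpotent ideal). A maximal subgroup of $S$ is the group of units of $eSe$ for an idempotent $e$. *)

theory Defs
  imports HOL.Vector_Spaces
begin

section \<open>Finite semigroups with commuting idempotents\<close>

definition idempotent :: "'a::times \<Rightarrow> bool" where
  "idempotent e \<longleftrightarrow> e * e = e"

definition inverse_of :: "'a::times \<Rightarrow> 'a \<Rightarrow> bool" where
  "inverse_of s t \<longleftrightarrow> s * t * s = s \<and> t * s * t = t"

definition Reg :: "'a::times set" where
  "Reg = {s. \<exists>t. inverse_of s t}"

text \<open>Meaningful on \<^const>\<open>Reg\<close> when idempotents commute; see \<open>inverse_of_sinv\<close> and
  \<open>inverse_of_unique\<close> below.\<close>

definition sinv :: "'a::times \<Rightarrow> 'a" where
  "sinv s = (THE t. inverse_of s t)"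

definition nat_le :: "('a::times \<times> 'a) set" where
  "nat_le = {(t, s). t \<in> Reg \<and> s \<in> Reg \<and> (\<exists>e. idempotent e \<and> t = e * s)}"

definition down :: "'a::times \<Rightarrow> 'a set" where
  "down s = {u \<in> Reg. u * sinv u * s = u}"

definition unit_group :: "'a::times \<Rightarrow> 'a set" where
  "unit_group e =
    {x \<in> {e * s * e | s. True}. \<exists>y \<in> {e * s * e | s. True}. x * y = e \<and> y * x = e}"

definition maximal_subgroup :: "'a::times set \<Rightarrow> bool" where
  "maximal_subgroup G \<longleftrightarrow> (\<exists>e. idempotent e \<and> G = unit_group e)"

lemma nat_le_partial_order:
  assumes comm: "\<And>e f :: 'a::semigroup_mult. idempotent e \<Longrightarrow> idempotent f \<Longrightarrow> e * f = f * e"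
  shows "partial_order_on (Reg :: 'a set) nat_le"
proof -
  have "(s, s) \<in> nat_le" if "s \<in> Reg" for s :: 'a
  proof -
    obtain t where t: "s * t * s = s" "t * s * t = t"
      using \<open>s \<in> Reg\<close> by (auto simp: Reg_def inverse_of_def)
    have "idempotent (s * t)"
      using t by (simp add: idempotent_def flip: mult.assoc)
    then show ?thesis
      using t(1) that unfolding nat_le_def mem_Collect_eq prod.case
      by (intro conjI exI[of _ "s * t"]) simp_all
  qed
  moreover have "s = t" if "(s, t) \<in> nat_le" "(t, s) \<in> nat_le" for s t :: 'a
  proof -
    obtain e where e: "idempotent e" "s = e * t"
      using \<open>(s, t) \<in> nat_le\<close> unfolding nat_le_def mem_Collect_eq prod.case by (elim conjE exE)
    obtain f where f: "idempotent f" "t = f * s"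
      using \<open>(t, s) \<in> nat_le\<close> unfolding nat_le_def mem_Collect_eq prod.case by (elim conjE exE)
    note ef = e(1) f(1) e(2) f(2)
    have es: "e * s = s"
      using ef(1,3) by (metis idempotent_def mult.assoc)
    have "t = f * (e * s)"
      using ef(4) es by simp
    also have "\<dots> = e * (f * s)"
      using comm[OF ef(1,2)] by (simp flip: mult.assoc)
    also have "\<dots> = s"
      by (simp only: ef(3,4)[symmetric])
    finally show ?thesis by simp
  qed
  moreover have "(r, t) \<in> nat_le" if "(r, s) \<in> nat_le" "(s, t) \<in> nat_le" for r s t :: 'a
  proof -
    obtain e where e: "idempotent e" "r = e * s"
      using \<open>(r, s) \<in> nat_le\<close> unfolding nat_le_def mem_Collect_eq prod.case by (elim conjE exE)
    obtain f where f: "idempotent f" "s = f * t"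
      using \<open>(s, t) \<in> nat_le\<close> unfolding nat_le_def mem_Collect_eq prod.case by (elim conjE exE)
    note ef = e(1) f(1) e(2) f(2)
    have "idempotent (e * f)"
      using ef(1,2) comm[OF ef(1,2)] by (metis idempotent_def mult.assoc)
    moreover have "r = (e * f) * t"
      using ef(3,4) by (simp add: mult.assoc)
    moreover have "r \<in> Reg" "t \<in> Reg"
      using that by (simp_all add: nat_le_def)
    ultimately show ?thesis
      unfolding nat_le_def mem_Collect_eq prod.case by (intro conjI exI)
  qed
  moreover have "nat_le \<subseteq> Reg \<times> (Reg :: 'a set)"
    by (auto simp: nat_le_def)
  ultimately show ?thesis
    unfolding partial_order_on_def preorder_on_def
    by (intro conjI refl_onI transI antisymI) assumption+
qed

lemma inverse_of_unique:
  assumes comm: "\<And>e f :: 'a::semigroup_mult. idempotent e \<Longrightarrow> idempotent f \<Longrightarrow> e * f = f * e"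
    and t: "inverse_of s t" and t': "inverse_of (s :: 'a) t'"
  shows "t = t'"
proof -
  have ids: "idempotent (s * t)" "idempotent (t * s)" "idempotent (s * t')" "idempotent (t' * s)"
    using t t' by (simp_all add: idempotent_def inverse_of_def flip: mult.assoc)
  have "t = (t * s) * (t' * s) * t"
    using t t' by (metis inverse_of_def mult.assoc)
  also have "\<dots> = (t' * s) * (t * s) * t"
    using comm[OF ids(2,4)] by simp
  also have "\<dots> = t' * s * t"
    using t by (simp add: inverse_of_def mult.assoc)
  also have "\<dots> = t' * (s * t') * (s * t)"
    using t' by (metis inverse_of_def mult.assoc)
  also have "\<dots> = t' * (s * t) * (s * t')"
    using comm[OF ids(1,3)] by (simp add: mult.assoc)
  also have "\<dots> = t'"
    using t t' by (metis inverse_of_def mult.assoc)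
  finally show ?thesis .
qed

lemma inverse_of_sinv:
  assumes "\<And>e f :: 'a::semigroup_mult. idempotent e \<Longrightarrow> idempotent f \<Longrightarrow> e * f = f * e"
    and "(s :: 'a) \<in> Reg"
  shows "inverse_of s (sinv s)"
proof -
  obtain t where t: "inverse_of s t"
    using assms(2) by (auto simp: Reg_def)
  show ?thesis
    unfolding sinv_def
    by (rule theI[where P = "inverse_of s", OF t]) (rule inverse_of_unique[OF assms(1) _ t])
qed

lemma Reg_mult:
  assumes comm: "\<And>e f :: 'a::semigroup_mult. idempotent e \<Longrightarrow> idempotent f \<Longrightarrow> e * f = f * e"
    and "s \<in> Reg" "(u :: 'a) \<in> Reg"
  shows "s * u \<in> Reg"
proof -
  obtain t v where t: "inverse_of s t" and v: "inverse_of u v"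
    using assms(2,3) by (auto simp: Reg_def)
  have c: "(u * v) * (t * s) = (t * s) * (u * v)"
    using t v by (intro comm) (simp_all add: idempotent_def inverse_of_def flip: mult.assoc)
  have "s * u * (v * t) * (s * u) = s * ((u * v) * (t * s)) * u"
    by (simp add: mult.assoc)
  also have "\<dots> = (s * t * s) * (u * v * u)"
    unfolding c by (simp add: mult.assoc)
  also have "\<dots> = s * u"
    using t v by (simp add: inverse_of_def)
  finally have 1: "s * u * (v * t) * (s * u) = s * u" .
  have "v * t * (s * u) * (v * t) = v * ((t * s) * (u * v)) * t"
    by (simp add: mult.assoc)
  also have "\<dots> = (v * u * v) * (t * s * t)"
    unfolding c[symmetric] by (simp add: mult.assoc)
  also have "\<dots> = v * t"
    using t v by (simp add: inverse_of_def)
  finally have "inverse_of (s * u) (v * t)"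
    using 1 by (simp add: inverse_of_def)
  then show ?thesis
    by (auto simp: Reg_def)
qed

section \<open>The Moebius function of a finite poset\<close>

text \<open>The guard only serves to make the recursion terminate for arbitrary arguments.\<close>

function mobius :: "'a set \<Rightarrow> ('a \<times> 'a) set \<Rightarrow> 'a \<Rightarrow> 'a \<Rightarrow> int" where
  "mobius P r x y =
    (if finite P \<and> partial_order_on P r \<and> (x, y) \<in> r
     then if x = y then 1 else - (\<Sum>z \<in> {z \<in> P. (x, z) \<in> r \<and> (z, y) \<in> r \<and> z \<noteq> y}. mobius P r x z)
     else 0)"
  by auto
termination
proof (relation "measure (\<lambda>(P, r, x, y). card {z \<in> P. (x, z) \<in> r \<and> (z, y) \<in> r})", goal_cases)
  case (2 P r x y z)
  then have P: "finite P" "partial_order_on P r" and z: "z \<in> P" "(x, z) \<in> r" "(z, y) \<in> r" "z \<noteq> y"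
    and xy: "(x, y) \<in> r"
    by auto
  have tr: "trans r" and as: "antisym r" and sub: "r \<subseteq> P \<times> P" and rf: "refl_on P r"
    using P(2) by (auto simp: partial_order_on_def preorder_on_def)
  have "{w \<in> P. (x, w) \<in> r \<and> (w, z) \<in> r} \<subset> {w \<in> P. (x, w) \<in> r \<and> (w, y) \<in> r}"
  proof
    show "{w \<in> P. (x, w) \<in> r \<and> (w, z) \<in> r} \<subseteq> {w \<in> P. (x, w) \<in> r \<and> (w, y) \<in> r}"
      using tr z(3) by (auto dest: transD)
    have "y \<in> {w \<in> P. (x, w) \<in> r \<and> (w, y) \<in> r}"
      using xy sub rf by (auto simp: refl_on_def)
    moreover have "(y, z) \<notin> r"
      using as z(3,4) by (auto dest: antisymD)
    ultimately show "{w \<in> P. (x, w) \<in> r \<and> (w, z) \<in> r} \<noteq> {w \<in> P. (x, w) \<in> r \<and> (w, y) \<in> r}"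
      by blast
  qed
  then show ?case
    using P(1) by (auto intro!: psubset_card_mono)
qed simp

declare mobius.simps [simp del]

section \<open>The semigroup algebra\<close>

typedef ('a, 'k) salg = "UNIV :: ('a \<Rightarrow> 'k) set"
  morphisms coef Salg ..

setup_lifting type_definition_salg

lemma salg_eqI: "(\<And>s. coef x s = coef y s) \<Longrightarrow> x = y"
  by (simp add: coef_inject[symmetric] fun_eq_iff)

instantiation salg :: (type, ab_group_add) ab_group_add
begin

lift_definition zero_salg :: "('a, 'b) salg" is "\<lambda>_ . 0" .
lift_definition plus_salg :: "('a, 'b) salg \<Rightarrow> ('a, 'b) salg \<Rightarrow> ('a, 'b) salg"
  is "\<lambda>f g s. f s + g s" .
lift_definition minus_salg :: "('a, 'b) salg \<Rightarrow> ('a, 'b) salg \<Rightarrow> ('a, 'b) salg"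
  is "\<lambda>f g s. f s - g s" .
lift_definition uminus_salg :: "('a, 'b) salg \<Rightarrow> ('a, 'b) salg"
  is "\<lambda>f s. - f s" .

instance
  by standard (transfer; simp add: fun_eq_iff algebra_simps)+

end

instantiation salg :: ("{finite, semigroup_mult}", ring) ring
begin

lift_definition times_salg :: "('a, 'b) salg \<Rightarrow> ('a, 'b) salg \<Rightarrow> ('a, 'b) salg"
  is "\<lambda>f g u. \<Sum>(s, t) \<in> {(s, t). s * t = u}. f s * g t" .

instance
proof
  fix x y z :: "('a, 'b) salg"
  show "x * y * z = x * (y * z)"
  proof (transfer, rule ext)
    fix f g h :: "'a \<Rightarrow> 'b" and u :: 'a
    have "(\<Sum>(p, t) \<in> {(p, t). p * t = u}. (\<Sum>(a, b) \<in> {(a, b). a * b = p}. f a * g b) * h t)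
        = (\<Sum>((p, t), (a, b)) \<in> (SIGMA (p, t) : {(p, t). p * t = u}. {(a, b). a * b = p}).
              f a * g b * h t)"
      by (subst sum.Sigma[symmetric]) (auto simp: sum_distrib_right case_prod_unfold intro!: sum.cong)
    also have "\<dots> = (\<Sum>((a, q), (b, t)) \<in> (SIGMA (a, q) : {(a, q). a * q = u}. {(b, t). b * t = q}).
              f a * g b * h t)"
      by (rule sum.reindex_bij_witness[of _ "\<lambda>((a, q), (b, t)). ((a * b, t), (a, b))"
            "\<lambda>((p, t), (a, b)). ((a, b * t), (b, t))"]) (auto simp: mult.assoc)
    also have "\<dots> = (\<Sum>(a, q) \<in> {(a, q). a * q = u}.
              f a * (\<Sum>(b, t) \<in> {(b, t). b * t = q}. g b * h t))"
      by (subst sum.Sigma[symmetric])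
        (auto simp: sum_distrib_left case_prod_unfold mult.assoc intro!: sum.cong)
    finally show "(\<Sum>(p, t) \<in> {(p, t). p * t = u}. (\<Sum>(a, b) \<in> {(a, b). a * b = p}. f a * g b) * h t)
        = (\<Sum>(a, q) \<in> {(a, q). a * q = u}. f a * (\<Sum>(b, t) \<in> {(b, t). b * t = q}. g b * h t))" .
  qed
  show "(x + y) * z = x * z + y * z"
    by transfer (simp add: fun_eq_iff case_prod_unfold distrib_right sum.distrib)
  show "x * (y + z) = x * y + x * z"
    by transfer (simp add: fun_eq_iff case_prod_unfold distrib_left sum.distrib)
qed

end

lift_definition scale :: "'k::times \<Rightarrow> ('a, 'k) salg \<Rightarrow> ('a, 'k) salg" (infixr "*\<^sub>K" 75)
  is "\<lambda>c f s. c * f s" .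

lift_definition single :: "'a \<Rightarrow> ('a, 'k::zero_neq_one) salg"
  is "\<lambda>s t. if t = s then 1 else 0" .

lemma coef_add [simp]:
  "coef 0 s = 0" "coef (x + y) s = coef x s + coef y s" "coef (x - y) s = coef x s - coef y s"
  "coef (- x) s = - coef x s"
  by (transfer; simp)+

lemma coef_scale [simp]: "coef (c *\<^sub>K x) s = c * coef x s"
  by transfer simp

lemma coef_single [simp]: "coef (single t) s = (if s = t then 1 else 0)"
  by transfer simp

lemma coef_times:
  "coef (x * y) u = (\<Sum>(s, t) \<in> {(s, t). s * t = u}. coef x s * coef y t)"
  by transfer simp

lemma coef_sum [simp]: "coef (sum f A) s = (\<Sum>i\<in>A. coef (f i) s)"
  by (induction A rule: infinite_finite_induct) auto

lemma salg_expand: "x = (\<Sum>s\<in>UNIV. coef x s *\<^sub>K single s)"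
  for x :: "('a::finite, 'k::field) salg"
  by (rule salg_eqI) (simp add: if_distrib[of "\<lambda>c. _ * c"] cong: if_cong)

global_interpretation salg: finite_dimensional_vector_space
  "(*\<^sub>K) :: 'k::field \<Rightarrow> ('a::finite, 'k) salg \<Rightarrow> ('a, 'k) salg" "range single"
proof (unfold_locales, goal_cases)
  case (6)
  interpret vector_space "(*\<^sub>K) :: 'k::field \<Rightarrow> ('a::finite, 'k) salg \<Rightarrow> ('a, 'k) salg"
    by unfold_locales (auto intro!: salg_eqI simp: algebra_simps)
  show ?case
  proof (rule independent_if_scalars_zero)
    fix f :: "('a, 'k) salg \<Rightarrow> 'k" and x :: "('a, 'k) salg"
    have inj: "inj (single :: 'a \<Rightarrow> ('a, 'k) salg)"
      by (rule injI) (metis coef_single zero_neq_one)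
    assume "(\<Sum>x\<in>range single. f x *\<^sub>K x) = 0" and "x \<in> range single"
    then obtain t where 0: "(\<Sum>s\<in>UNIV. f (single s) *\<^sub>K single s) = (0 :: ('a, 'k) salg)"
      and t: "x = single t"
      by (auto simp: sum.reindex[OF inj])
    have "coef (\<Sum>s\<in>UNIV. f (single s) *\<^sub>K single s :: ('a, 'k) salg) t = 0"
      unfolding 0 by simp
    then show "f x = 0"
      by (simp add: t if_distrib[of "\<lambda>c. _ * c"] cong: if_cong)
  qed simp
next
  case 7
  interpret vector_space "(*\<^sub>K) :: 'k::field \<Rightarrow> ('a::finite, 'k) salg \<Rightarrow> ('a, 'k) salg"
    by unfold_locales (auto intro!: salg_eqI simp: algebra_simps)
  have "x \<in> span (range single)" for x :: "('a, 'k) salg"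
    by (subst salg_expand[of x], rule span_sum, rule span_scale, rule span_base) simp
  then show ?case by auto
qed (auto intro!: salg_eqI simp: algebra_simps)

definition KR :: "('a::times, 'k::zero) salg set" where
  "KR = {x. \<forall>s. s \<notin> Reg \<longrightarrow> coef x s = 0}"

definition floor_elt :: "'a::{finite, semigroup_mult} \<Rightarrow> ('a, 'k::field) salg" where
  "floor_elt s =
    (\<Sum>t \<in> {t \<in> Reg. (t, s) \<in> nat_le}. of_int (mobius Reg nat_le t s) *\<^sub>K single t)"

definition nu :: "('a::{finite, semigroup_mult}, 'k::field) salg \<Rightarrow> ('a, 'k) salg" where
  "nu x = (\<Sum>s\<in>UNIV. coef x s *\<^sub>K (\<Sum>t \<in> down s. floor_elt t))"

lemma nu_single: "nu (single s) = (\<Sum>t \<in> down s. floor_elt t)"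
  by (rule salg_eqI) (simp add: nu_def if_distrib[of "\<lambda>c. c * _"] cong: if_cong)

section \<open>Algebra homomorphisms, ideals, radicals and quotients\<close>

definition subalgebra :: "('a::{finite, semigroup_mult}, 'k::field) salg set \<Rightarrow> bool" where
  "subalgebra A \<longleftrightarrow> salg.subspace A \<and> (\<forall>x\<in>A. \<forall>y\<in>A. x * y \<in> A)"

definition algebra_hom ::
    "('a::{finite, semigroup_mult}, 'k::field) salg set \<Rightarrow> ('a, 'k) salg set \<Rightarrow>
      (('a, 'k) salg \<Rightarrow> ('a, 'k) salg) \<Rightarrow> bool" where
  "algebra_hom A B f \<longleftrightarrow>
    (\<forall>x\<in>A. f x \<in> B) \<and> (\<forall>c. \<forall>x\<in>A. f (c *\<^sub>K x) = c *\<^sub>K f x) \<and>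
    (\<forall>x\<in>A. \<forall>y\<in>A. f (x + y) = f x + f y \<and> f (x * y) = f x * f y)"

definition algebra_ideal ::
    "('a::{finite, semigroup_mult}, 'k::field) salg set \<Rightarrow> ('a, 'k) salg set \<Rightarrow> bool" where
  "algebra_ideal A I \<longleftrightarrow>
    I \<subseteq> A \<and> salg.subspace I \<and> (\<forall>a\<in>A. \<forall>x\<in>I. a * x \<in> I \<and> x * a \<in> I)"

text \<open>\<open>products I n\<close> is the set of all products of \<open>n + 1\<close> elements of \<open>I\<close>; the shift is
  needed because the algebra need not have a unit.\<close>

primrec products :: "'b::times set \<Rightarrow> nat \<Rightarrow> 'b set" where
  "products I 0 = I"
| "products I (Suc n) = {x * y | x y. x \<in> I \<and> y \<in> products I n}"

definition nilpotent :: "'b::ring set \<Rightarrow> bool" where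
  "nilpotent I \<longleftrightarrow> (\<exists>n. products I n \<subseteq> {0})"

text \<open>\<^const>\<open>Greatest\<close> refers to inclusion: this is the largest nilpotent ideal of \<open>A\<close>, which
  exists by \<open>Rad_largest\<close> below.\<close>

definition Rad :: "('a::{finite, semigroup_mult}, 'k::field) salg set \<Rightarrow> ('a, 'k) salg set" where
  "Rad A = (GREATEST I. algebra_ideal A I \<and> nilpotent I)"

definition coset :: "'b::plus \<Rightarrow> 'b set \<Rightarrow> 'b set" where
  "coset x I = {x + i | i. i \<in> I}"

definition quotient :: "'b::plus set \<Rightarrow> 'b set \<Rightarrow> 'b set set" where
  "quotient A I = {coset x I | x. x \<in> A}"

text \<open>The operations of the quotient algebra, written without a choice of representatives; for an
  ideal \<open>I\<close> the unions are over equal cosets.\<close>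

definition q_add :: "'b::ring set \<Rightarrow> 'b set \<Rightarrow> 'b set \<Rightarrow> 'b set" where
  "q_add I X Y = (\<Union>x\<in>X. \<Union>y\<in>Y. coset (x + y) I)"

definition q_mult :: "'b::ring set \<Rightarrow> 'b set \<Rightarrow> 'b set \<Rightarrow> 'b set" where
  "q_mult I X Y = (\<Union>x\<in>X. \<Union>y\<in>Y. coset (x * y) I)"

definition q_scale :: "('a, 'k::field) salg set \<Rightarrow> 'k \<Rightarrow> ('a, 'k) salg set \<Rightarrow> ('a, 'k) salg set" where
  "q_scale I c X = (\<Union>x\<in>X. coset (c *\<^sub>K x) I)"

definition quotient_iso ::
    "('a::{finite, semigroup_mult}, 'k::field) salg set \<Rightarrow> ('a, 'k) salg set \<Rightarrow>
     ('a, 'k) salg set \<Rightarrow> ('a, 'k) salg set \<Rightarrow>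
     (('a, 'k) salg set \<Rightarrow> ('a, 'k) salg set) \<Rightarrow> bool" where
  "quotient_iso A I B J \<Phi> \<longleftrightarrow>
    bij_betw \<Phi> (quotient A I) (quotient B J) \<and>
    (\<forall>X\<in>quotient A I. \<forall>Y\<in>quotient A I.
       \<Phi> (q_add I X Y) = q_add J (\<Phi> X) (\<Phi> Y) \<and> \<Phi> (q_mult I X Y) = q_mult J (\<Phi> X) (\<Phi> Y)) \<and>
    (\<forall>c. \<forall>X\<in>quotient A I. \<Phi> (q_scale I c X) = q_scale J c (\<Phi> X))"

definition basis_of ::
    "('a::finite, 'k::field) salg set \<Rightarrow> ('a, 'k) salg set \<Rightarrow> bool" where
  "basis_of V B \<longleftrightarrow> salg.independent B \<and> salg.span B = V"

lemma subalgebra_UNIV: "subalgebra UNIV"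
  by (simp add: subalgebra_def)

lemma subalgebra_KR:
  assumes comm: "\<And>e f :: 'a::{finite, semigroup_mult}.
      idempotent e \<Longrightarrow> idempotent f \<Longrightarrow> e * f = f * e"
  shows "subalgebra (KR :: ('a, 'k::field) salg set)"
proof -
  have "x * y \<in> KR" if xy: "x \<in> KR" "y \<in> KR" for x y :: "('a, 'k) salg"
  proof -
    have "coef x s * coef y t = 0" if "s * t \<notin> Reg" for s t
      using that Reg_mult[OF comm, of s t] xy by (auto simp: KR_def)
    then show ?thesis
      by (auto simp: KR_def coef_times intro!: sum.neutral)
  qed
  moreover have "salg.subspace (KR :: ('a, 'k) salg set)"
    by (rule salg.subspaceI) (auto simp: KR_def)
  ultimately show ?thesis
    by (simp add: subalgebra_def)
qed

lemma products_split:
  fixes I :: "'b::semigroup_mult set"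
  assumes "z \<in> products I (a + Suc b)"
  shows "\<exists>x\<in>products I a. \<exists>y\<in>products I b. z = x * y"
  using assms
proof (induction a arbitrary: z)
  case (Suc a)
  then obtain x w where "z = x * w" "x \<in> I" "w \<in> products I (a + Suc b)"
    by auto
  moreover obtain p q where "p \<in> products I a" "q \<in> products I b" "w = p * q"
    using Suc.IH[OF \<open>w \<in> _\<close>] by blast
  ultimately have "x * p \<in> products I (Suc a)" "z = (x * p) * q"
    by (auto simp: mult.assoc)
  then show ?case
    using \<open>q \<in> _\<close> by blast
qed auto

lemma nilpotent_ideal_sum:
  assumes A: "subalgebra A" and I: "algebra_ideal A I" "nilpotent I"
    and J: "algebra_ideal A J" "nilpotent J"
  shows "algebra_ideal A {x + y | x y. x \<in> I \<and> y \<in> J} \<and> nilpotent {x + y | x y. x \<in> I \<and> y \<in> J}"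
proof -
  define K where "K = {x + y | x y. x \<in> I \<and> y \<in> J}"
  have sub: "I \<subseteq> A" "J \<subseteq> A" "salg.subspace I" "salg.subspace J" "salg.subspace A"
    using A I J by (auto simp: algebra_ideal_def subalgebra_def)
  have mI: "a * x \<in> I" "x * a \<in> I" if "a \<in> A" "x \<in> I" for a x
    using I(1) that by (auto simp: algebra_ideal_def)
  have mJ: "a * x \<in> J" "x * a \<in> J" if "a \<in> A" "x \<in> J" for a x
    using J(1) that by (auto simp: algebra_ideal_def)
  have "K \<subseteq> A"
    using sub by (auto simp: K_def intro!: salg.subspace_add)
  moreover have "salg.subspace K"
    unfolding K_def using sub(3,4) by (rule salg.subspace_sums)
  moreover have "a * x \<in> K" "x * a \<in> K" if "a \<in> A" "x \<in> K" for a x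
  proof -
    obtain i j where x: "x = i + j" "i \<in> I" "j \<in> J"
      using \<open>x \<in> K\<close> by (auto simp: K_def)
    show "a * x \<in> K"
      unfolding K_def x(1) distrib_left using mI mJ that(1) x(2,3) by blast
    show "x * a \<in> K"
      unfolding K_def x(1) distrib_right using mI mJ that(1) x(2,3) by blast
  qed
  ultimately have "algebra_ideal A K"
    by (auto simp: algebra_ideal_def)
  obtain n where n: "products I n \<subseteq> {0}"
    using I(2) by (auto simp: nilpotent_def)
  obtain m where m: "products J m \<subseteq> {0}"
    using J(2) by (auto simp: nilpotent_def)
  have prodI: "products I k \<subseteq> I" for k
    by (induction k) (use mI sub in auto)
  have dec: "\<exists>p\<in>products I k. \<exists>j\<in>J. z = p + j" if "z \<in> products K k" for k z
    using that
  proof (induction k arbitrary: z)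
    case (Suc k)
    then obtain x w where z: "z = x * w" "x \<in> K" "w \<in> products K k"
      by auto
    obtain i j where x: "x = i + j" "i \<in> I" "j \<in> J"
      using z(2) by (auto simp: K_def)
    obtain p j' where w: "w = p + j'" "p \<in> products I k" "j' \<in> J"
      using Suc.IH[OF z(3)] by blast
    have "i * p \<in> products I (Suc k)"
      using x(2) w(2) by auto
    moreover have "i \<in> A" "p \<in> A"
      using x(2) w(2) prodI[of k] sub(1) by auto
    moreover have "j * j' \<in> J"
      using mJ(1) x(3) w(3) sub(2) by blast
    ultimately have "i * j' + (j * p + j * j') \<in> J"
      using mJ x(3) w(3) sub(4) by (auto intro!: salg.subspace_add)
    moreover have "z = i * p + (i * j' + (j * p + j * j'))"
      by (simp add: z(1) x(1) w(1) algebra_simps)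
    ultimately show ?case
      using \<open>i * p \<in> _\<close> by blast
  qed (auto simp: K_def)
  have KJ: "products K n \<subseteq> J"
    using dec[of _ n] n by fastforce
  have "\<exists>N. products K N \<subseteq> products J k" for k
  proof (induction k)
    case (Suc k)
    then obtain N where N: "products K N \<subseteq> products J k" by blast
    have "products K (n + Suc N) \<subseteq> products J (Suc k)"
    proof
      fix z assume "z \<in> products K (n + Suc N)"
      from products_split[OF this] show "z \<in> products J (Suc k)"
        using KJ N by auto
    qed
    then show ?case by blast
  qed (use KJ in auto)
  then have "nilpotent K"
    unfolding nilpotent_def using m by blast
  with \<open>algebra_ideal A K\<close> show ?thesis
    by (simp add: K_def)
qed

lemma Rad_largest:
  fixes A :: "('a::{finite, semigroup_mult}, 'b::field) salg set"
  assumes A: "subalgebra A"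
  shows "algebra_ideal A (Rad A)" and "nilpotent (Rad A)"
    and "algebra_ideal A I \<Longrightarrow> nilpotent I \<Longrightarrow> I \<subseteq> Rad A"
proof -
  let ?P = "\<lambda>I. algebra_ideal A I \<and> nilpotent I"
  have "?P {0}"
    using A by (auto simp: algebra_ideal_def subalgebra_def salg.subspace_0 nilpotent_def
        intro!: exI[of _ 0])
  moreover have "\<forall>I. ?P I \<longrightarrow> salg.dim I < Suc (salg.dim (UNIV :: ('a, 'b) salg set))"
    using salg.dim_subset[OF subset_UNIV] by (auto simp: less_Suc_eq_le simp del: salg.dim_UNIV)
  ultimately have "\<exists>J. ?P J \<and> (\<forall>I. ?P I \<longrightarrow> salg.dim I \<le> salg.dim J)"
    by (rule ex_has_greatest_nat[of ?P "{0}" salg.dim])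
  then obtain J where J: "?P J" and max: "\<And>I. ?P I \<Longrightarrow> salg.dim I \<le> salg.dim J"
    by blast
  have le: "I \<subseteq> J" if "?P I" for I
  proof -
    let ?K = "{x + y | x y. x \<in> I \<and> y \<in> J}"
    have K: "?P ?K"
      using nilpotent_ideal_sum[OF A] J that by blast
    have 0: "0 \<in> I" "0 \<in> J"
      using J that by (auto simp: algebra_ideal_def salg.subspace_0)
    have "J \<subseteq> ?K"
      using 0(1) by force
    then have "J = ?K"
      using salg.subspace_dim_equal[of J ?K] J K max[OF K] by (auto simp: algebra_ideal_def)
    moreover have "I \<subseteq> ?K"
      using 0(2) by force
    ultimately show ?thesis by simp
  qed
  have RJ: "Rad A = J"
    unfolding Rad_def by (rule Greatest_equality) (fact J, fact le)
  show "algebra_ideal A (Rad A)" "nilpotent (Rad A)"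
    unfolding RJ using J by blast+
  show "I \<subseteq> Rad A" if "algebra_ideal A I" "nilpotent I"
    unfolding RJ using le that by blast
qed

end

theory Submission
  imports Defs
begin

text \<open>The starting point is that a floor element \<open>floor_elt t\<close> behaves like an arrow of a
  groupoid from \<open>sinv t * t\<close> to \<open>t * sinv t\<close>: by Moebius inversion every
  regular \<open>s\<close> is the sum of the floor elements below it, and two floor elements
  multiply to the floor element of the product if the arrows compose and to \<open>0\<close>
  otherwise (\<open>floor_elt_mult\<close>). Both this product rule and multiplicativity of
  \<^const>\<open>nu\<close> rest on one bijection, valid for arbitrary \<open>s\<close> and
  \<open>s'\<close>: the composable pairs in \<open>down s \<times> down s'\<close> correspond to
  \<open>down (s * s')\<close> via multiplication (\<open>down_mult_bij\<close>). For regular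
  \<open>s\<close> the set \<open>down s\<close> is the order ideal below \<open>s\<close>, so
  \<open>nu\<close> is the identity on the algebra of the regular elements.

  The coefficient of \<open>floor_elt t\<close> in \<open>nu x\<close> is the sum of the
  coefficients of \<open>x\<close> over all \<open>s\<close> with \<open>t \<in> down s\<close>,
  and these sums vanish on the kernel. If \<open>e\<close> is an idempotent and \<open>u\<close>
  is regular with \<open>sinv u * u = e\<close>, then \<open>s * e = u\<close> is equivalent to
  \<open>u \<in> down s\<close>. Hence in \<open>x * single e\<close>, for \<open>x\<close> in the
  kernel, all such \<open>u\<close> cancel, and only elements remain that lie strictly below
  \<open>e\<close> in the sense that the ideal they generate misses \<open>e\<close>
  (\<open>kernel_mult_idempotent\<close>). Every sufficiently long product in a finite semigroup
  has an idempotent factor, so a high power of the kernel is pushed to elements below which there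
  are fewer and fewer idempotents. As no element has fewer than zero of them, the kernel is
  nilpotent.

  An algebra homomorphism onto a subalgebra with nilpotent kernel matches the two radicals, which
  gives the isomorphism of the quotients. Finally, if the order of each maximal subgroup is
  invertible in the field, then the algebra of the regular elements has no nonzero nilpotent
  ideal: multiplying by floor elements on both sides moves a nonzero element of such an ideal into
  the group algebra of a maximal subgroup, where Maschke's averaging argument applies
  (\<open>nilpotent_left_ideal_of_group_span\<close>). The radical is then the kernel itself, and
  the elements \<open>single s - nu (single s)\<close> for irregular \<open>s\<close> span it
  because \<open>x = x - nu x\<close> on the kernel.\<close>

section \<open>Idempotents in finite semigroups\<close>

text \<open>In a minimal subsemigroup, left multiplication by \<open>t\<close> is onto, so some \<open>x\<close>
  has \<open>t * x = t\<close>. The set of all such \<open>x\<close> is again a subsemigroup, by minimality the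
  whole one, and \<open>x = t\<close> is a possible choice.\<close>

lemma closed_set_has_idempotent:
  fixes T :: "'a::{finite, semigroup_mult} set"
  assumes "T \<noteq> {}" "\<And>x y. x \<in> T \<Longrightarrow> y \<in> T \<Longrightarrow> x * y \<in> T"
  shows "\<exists>e\<in>T. idempotent e"
  using assms
proof (induction "card T" arbitrary: T rule: less_induct)
  case less
  have step: "\<exists>e\<in>T. idempotent e"
    if "T' \<subset> T" "T' \<noteq> {}" "\<And>x y. x \<in> T' \<Longrightarrow> y \<in> T' \<Longrightarrow> x * y \<in> T'" for T'
    using less.hyps[of T'] that psubset_card_mono[of T T'] by auto
  obtain t where t: "t \<in> T"
    using less.prems(1) by blast
  show ?case
  proof (cases "(*) t ` T = T")
    case False
    have "(*) t ` T \<subset> T"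
      using False t less.prems(2) by blast
    moreover have "x * y \<in> (*) t ` T" if xy: "x \<in> (*) t ` T" "y \<in> (*) t ` T" for x y
    proof -
      obtain a b where ab: "x = t * a" "y = t * b" "a \<in> T" "b \<in> T"
        using xy by blast
      have "x * y = t * (a * (t * b))"
        by (simp add: ab mult.assoc)
      moreover have "a * (t * b) \<in> T"
        using ab t less.prems(2) by blast
      ultimately show ?thesis by blast
    qed
    ultimately show ?thesis
      using t by (intro step) auto
  next
    case True
    let ?F = "{x \<in> T. t * x = t}"
    have "t \<in> (*) t ` T"
      using True t by simp
    then have "?F \<noteq> {}" by force
    moreover have "x * y \<in> ?F" if "x \<in> ?F" "y \<in> ?F" for x y
      using that less.prems(2) by (auto simp flip: mult.assoc)
    ultimately consider "?F = T" | "\<exists>e\<in>T. idempotent e"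
      using step[of ?F] by blast
    then show ?thesis
      using t by cases (auto simp: idempotent_def)
  qed
qed

text \<open>Finite semigroups are stable: iterating \<open>e = (p * u) * e * q\<close> replaces \<open>p *
  u\<close> by an idempotent \<open>g\<close> that still fixes \<open>e\<close> on the left.\<close>

lemma stability:
  fixes e u :: "'a::{finite, semigroup_mult}"
  assumes e: "e = p * u * q" and ue: "u * e = u"
  shows "\<exists>v. e = v * u"
proof -
  \<comment> \<open>Left multiples of \<open>u\<close> that can serve in place of \<open>p * u\<close>.\<close>
  let ?T = "{t. (\<exists>p. t = p * u) \<and> (\<exists>q. e = t * e * q)}"
  have "p * u * e = p * u"
    using ue by (simp add: mult.assoc)
  then have "p * u \<in> ?T"
    using e by auto
  moreover have "s * t \<in> ?T" if st: "s \<in> ?T" "t \<in> ?T" for s t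
  proof -
    obtain a b c where "e = s * e * a" "e = t * e * b" "t = c * u"
      using st by blast
    then have "e = s * t * e * (b * a)" "s * t = (s * c) * u"
      by (metis mult.assoc)+
    then show ?thesis by blast
  qed
  ultimately obtain g where "g \<in> ?T" and g: "idempotent g"
    using closed_set_has_idempotent[of ?T] by blast
  then obtain v q' where v: "g = v * u" and q': "e = g * e * q'"
    by blast
  have "g * e = e"
    using g q' by (metis idempotent_def mult.assoc)
  then have "e = v * u"
    using v ue by (metis mult.assoc)
  then show ?thesis ..
qed

text \<open>Counting these idempotents gives a measure of depth in the semigroup that is monotone under
  multiplication.\<close>

definition idem_below :: "'a::semigroup_mult \<Rightarrow> 'a set" where
  "idem_below u = {e. idempotent e \<and> (\<exists>p q. e = p * u * q)}"

lemma idem_below_mult: "idem_below (x * u) \<subseteq> idem_below u" "idem_below (u * y) \<subseteq> idem_below u"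
  by (fastforce simp: idem_below_def mult.assoc[symmetric])
     (fastforce simp: idem_below_def mult.assoc)

lemma idempotent_in_idem_below: "idempotent e \<Longrightarrow> e \<in> idem_below e"
  by (auto simp: idem_below_def idempotent_def intro!: exI[of _ e])

text \<open>Records the partial products read from the right end, as input for a pigeonhole argument.\<close>

lemma products_suffixes:
  fixes I :: "'b::semigroup_mult set"
  assumes "z \<in> products I n"
  shows "\<exists>q. q n = z \<and> q 0 \<in> I \<and> (\<forall>i<n. \<exists>b\<in>I. q (Suc i) = b * q i)"
  using assms
proof (induction n arbitrary: z)
  case 0
  then show ?case by (intro exI[of _ "\<lambda>_. z"]) auto
next
  case (Suc n)
  then obtain x y where xy: "z = x * y" "x \<in> I" "y \<in> products I n"
    by auto
  obtain q where q: "q n = y" "q 0 \<in> I" "\<forall>i<n. \<exists>b\<in>I. q (Suc i) = b * q i"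
    using Suc.IH[OF xy(3)] by blast
  show ?case
    using q xy by (intro exI[of _ "q(Suc n := z)"]) (auto simp: less_Suc_eq)
qed

text \<open>Among the suffixes of a product with more than \<open>card UNIV\<close> factors, two coincide. The
  factors in between fix the shorter suffix on the left, and the elements of \<open>I\<close> that
  do so form a subsemigroup.\<close>

lemma long_product_contains_idempotent:
  fixes I :: "'a::{finite, semigroup_mult} set"
  assumes I: "\<And>x y. x \<in> I \<Longrightarrow> y \<in> I \<Longrightarrow> x * y \<in> I"
    and z: "z \<in> products I (card (UNIV :: 'a set))"
  shows "\<exists>x e y. idempotent e \<and> e \<in> I \<and> z = x * e * y"
proof -
  let ?n = "card (UNIV :: 'a set)"
  obtain q where q: "q ?n = z" "\<And>i. i < ?n \<Longrightarrow> \<exists>b\<in>I. q (Suc i) = b * q i"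
    using products_suffixes[OF z] by blast
  have step: "\<exists>g\<in>I. q j = g * q i" if "i < j" "j \<le> ?n" for i j
    using that
  proof (induction j)
    case (Suc j)
    obtain b where b: "b \<in> I" "q (Suc j) = b * q j"
      using q(2)[of j] Suc.prems by auto
    show ?case
    proof (cases "i = j")
      case True
      then show ?thesis using b by auto
    next
      case False
      then obtain g where "g \<in> I" "q j = g * q i"
        using Suc by auto
      then show ?thesis
        using b I[of b g] by (auto intro!: bexI[of _ "b * g"] simp: mult.assoc)
    qed
  qed simp
  have "card (q ` {..?n}) \<le> ?n"
    by (intro card_mono) auto
  then have "\<not> inj_on q {..?n}"
    by (auto dest: card_image)
  then obtain i j where ij: "q i = q j" "i < j" "j \<le> ?n"
    unfolding inj_on_def by (auto elim!: linorder_neqE_nat) metis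
  obtain e where e: "idempotent e" "e \<in> I" "e * q i = q i"
  proof -
    have "\<exists>g\<in>I. g * q i = q i"
      using step[OF ij(2,3)] unfolding ij(1)[symmetric] by metis
    then have "\<exists>e\<in>{g \<in> I. g * q i = q i}. idempotent e"
      using I by (intro closed_set_has_idempotent) (auto simp: mult.assoc)
    then show ?thesis using that by blast
  qed
  have "\<exists>x. z = x * q i"
  proof (cases "i = ?n")
    case False
    then show ?thesis
      using step[of i ?n] ij(2,3) q(1) by auto
  next
    case True
    then show ?thesis
      using e(3) q(1) by metis
  qed
  then obtain x where "z = x * q i" ..
  then have "z = x * e * q i"
    using e(3) by (simp add: mult.assoc)
  then show ?thesis using e by blast
qed

text \<open>Ideals of the semigroup, increasing in \<open>k\<close>; the strict inequality makes \<open>low 0\<close> empty.\<close>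

definition low :: "nat \<Rightarrow> 'b::semigroup_mult set" where
  "low k = {u. card (idem_below u) < k}"

lemma low_mult:
  fixes u x y :: "'b::{finite, semigroup_mult}"
  shows "u \<in> low k \<Longrightarrow> x * u \<in> low k" "u \<in> low k \<Longrightarrow> u * y \<in> low k"
  unfolding low_def mem_Collect_eq
  by (erule le_less_trans[rotated], rule card_mono[OF finite idem_below_mult(1)],
      erule le_less_trans[rotated], rule card_mono[OF finite idem_below_mult(2)])

section \<open>Supports and products in the semigroup algebra\<close>

lemma scale_mult: "(c *\<^sub>K x) * y = c *\<^sub>K (x * y)" "x * (c *\<^sub>K y) = c *\<^sub>K (x * y)"
  for x y :: "('b::{finite, semigroup_mult}, 'k::field) salg"
  by (rule salg_eqI, simp add: coef_times sum_distrib_left case_prod_unfold algebra_simps)+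

lemma single_mult:
  "single s * single t = (single (s * t) :: ('b::{finite, semigroup_mult}, 'k::field) salg)"
proof (rule salg_eqI)
  fix u
  have "coef (single s * single t :: ('b, 'k) salg) u
      = (\<Sum>p \<in> {(a, b). a * b = u}. if p = (s, t) then 1 else 0)"
    unfolding coef_times by (intro sum.cong) (auto split: if_splits)
  then show "coef (single s * single t :: ('b, 'k) salg) u = coef (single (s * t)) u"
    by auto
qed

lemma products_mono: "A \<subseteq> B \<Longrightarrow> products A n \<subseteq> products B n"
  by (induction n) auto

text \<open>A power of a power contains a higher power. The exponent is only asserted to exist, which avoids
  tracking the shift by one in \<^const>\<open>products\<close>.\<close>

lemma products_products:
  fixes A :: "'b::semigroup_mult set"
  shows "\<exists>m'. products A m' \<subseteq> products (products A m) n"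
proof (induction n)
  case (Suc n)
  then obtain m' where m': "products A m' \<subseteq> products (products A m) n" by blast
  have "products A (m + Suc m') \<subseteq> products (products A m) (Suc n)"
  proof
    fix z assume "z \<in> products A (m + Suc m')"
    from products_split[OF this] show "z \<in> products (products A m) (Suc n)"
      using m' by auto
  qed
  then show ?case by blast
qed auto

definition supported_on :: "'b set \<Rightarrow> ('b, 'k::zero) salg set" where
  "supported_on A = {x. \<forall>s. s \<notin> A \<longrightarrow> coef x s = 0}"

lemma supported_on_mult:
  fixes x y :: "('b::{finite, semigroup_mult}, 'k::field) salg"
  assumes "x \<in> supported_on A" "y \<in> supported_on B"
  shows "x * y \<in> supported_on {a * b | a b. a \<in> A \<and> b \<in> B}"
proof -
  have "coef (x * y) u = 0" if u: "u \<notin> {a * b | a b. a \<in> A \<and> b \<in> B}" for u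
  proof -
    have "coef x s * coef y t = 0" if "s * t = u" for s t
      using assms u that by (auto simp: supported_on_def)
    then show ?thesis
      unfolding coef_times by (auto intro!: sum.neutral)
  qed
  then show ?thesis
    unfolding supported_on_def by simp
qed

lemma products_supported_on:
  "products (supported_on A :: ('b::{finite, semigroup_mult}, 'k::field) salg set) n
    \<subseteq> supported_on (products A n)"
proof (induction n)
  case (Suc n)
  then show ?case
    using supported_on_mult[of _ A _ "products A n"] by auto
qed simp

lemma mult_in_supported_on:
  fixes x z :: "('b::{finite, semigroup_mult}, 'k::field) salg"
  assumes z: "z \<in> supported_on A" and x: "\<And>s. s \<in> A \<Longrightarrow> x * single s \<in> supported_on B"
  shows "x * z \<in> supported_on B"
proof -
  have "x * z = (\<Sum>s\<in>UNIV. coef z s *\<^sub>K (x * single s))"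
    by (subst salg_expand[of z]) (simp add: sum_distrib_left scale_mult(2))
  moreover have "coef z s * coef (x * single s) u = 0" if "u \<notin> B" for s u
    using that z x[of s] by (cases "s \<in> A") (auto simp: supported_on_def)
  ultimately show ?thesis
    by (auto simp: supported_on_def intro!: sum.neutral)
qed

lemma coef_mult_single:
  "coef (x * single e) u = (\<Sum>s | s * e = u. coef x s)"
  for x :: "('b::{finite, semigroup_mult}, 'k::field) salg"
proof -
  have "coef (x * single e) u = (\<Sum>(s, t) \<in> (\<lambda>s. (s, e)) ` {s. s * e = u}. coef x s)"
    unfolding coef_times by (rule sum.mono_neutral_cong_right) (auto split: if_splits)
  then show ?thesis
    by (simp add: sum.reindex inj_on_def)
qed

section \<open>Averaging over a group of units\<close>

lemma nilpotent_no_idempotent: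
  assumes "nilpotent L" "c \<in> L" "c * c = c"
  shows "c = 0"
proof -
  have "c \<in> products L n" for n
    by (induction n) (use assms(2,3) in force)+
  then show ?thesis
    using assms(1) by (auto simp: nilpotent_def)
qed

text \<open>Maschke's argument. A linear projection onto \<open>L\<close>, averaged over the group
  \<open>U\<close>, commutes with left multiplication by \<open>U\<close>, so on the span of
  \<open>U\<close> it is right multiplication by an element \<open>c\<close> of \<open>L\<close>.
  As it fixes \<open>L\<close>, the element \<open>c\<close> is idempotent, thus \<open>0\<close>
  when \<open>L\<close> is nilpotent.\<close>

lemma nilpotent_left_ideal_of_group_span:
  fixes U L :: "('b::{finite, semigroup_mult}, 'k::field) salg set"
  assumes one: "\<epsilon> \<in> U"
    and closed: "\<And>u v. u \<in> U \<Longrightarrow> v \<in> U \<Longrightarrow> u * v \<in> U"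
    and unit: "\<And>u. u \<in> U \<Longrightarrow> \<epsilon> * u = u \<and> u * \<epsilon> = u"
    and inv: "\<And>u. u \<in> U \<Longrightarrow> \<exists>v\<in>U. v * u = \<epsilon> \<and> u * v = \<epsilon>"
    and card: "(of_nat (card U) :: 'k) \<noteq> 0"
    and L: "salg.subspace L" "L \<subseteq> salg.span U" "nilpotent L"
    and UL: "\<And>u x. u \<in> U \<Longrightarrow> x \<in> L \<Longrightarrow> u * x \<in> L"
  shows "L \<subseteq> {0}"
proof -
  interpret pair: vector_space_pair "(*\<^sub>K) :: 'k \<Rightarrow> ('b, 'k) salg \<Rightarrow> ('b, 'k) salg"
    "(*\<^sub>K) :: 'k \<Rightarrow> ('b, 'k) salg \<Rightarrow> ('b, 'k) salg" ..
  obtain P :: "('b, 'k) salg \<Rightarrow> ('b, 'k) salg"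
    where P: "range P \<subseteq> L" "Vector_Spaces.linear (*\<^sub>K) (*\<^sub>K) P" "\<And>x. x \<in> L \<Longrightarrow> P x = x"
    using pair.linear_exists_left_inverse_on[OF salg.linear_id L(1)] by auto
  interpret P: Vector_Spaces.linear "(*\<^sub>K) :: 'k \<Rightarrow> ('b, 'k) salg \<Rightarrow> ('b, 'k) salg" "(*\<^sub>K)" P
    by (rule P(2))
  obtain j where j: "\<And>u. u \<in> U \<Longrightarrow> j u \<in> U \<and> j u * u = \<epsilon> \<and> u * j u = \<epsilon>"
    using inv by metis
  have bij: "bij_betw ((*) h) U U" if h: "h \<in> U" for h
  proof (rule bij_betw_imageI)
    show "inj_on ((*) h) U"
    proof (rule inj_onI)
      fix u v assume uv: "u \<in> U" "v \<in> U" "h * u = h * v"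
      then have "(j h * h) * u = (j h * h) * v"
        by (simp add: mult.assoc)
      then show "u = v"
        using uv j[OF h] unit by simp
    qed
    show "(*) h ` U = U"
    proof (intro equalityI subsetI)
      fix u assume u: "u \<in> U"
      have "u = h * (j h * u)"
        using u h j unit by (simp flip: mult.assoc)
      then show "u \<in> (*) h ` U"
        using u h j closed by blast
    qed (use h closed in auto)
  qed
  have j_mult: "j (h * u) * h = j u" if "h \<in> U" "u \<in> U" for h u
  proof -
    have "j (h * u) * h = j (h * u) * h * (u * j u)"
    proof -
      have "j (h * u) * h \<in> U"
        using that j closed by blast
      then show ?thesis
        using that j unit by simp
    qed
    also have "\<dots> = (j (h * u) * (h * u)) * j u"
      by (simp add: mult.assoc)
    finally show ?thesis
      using that j unit closed by simp
  qed
  \<comment> \<open>The sum over the group; division by its order is postponed to the definition of \<open>c\<close>.\<close>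
  define p where "p x = (\<Sum>u\<in>U. u * P (j u * x))" for x
  have p_lin: "p (x + y) = p x + p y" "p (c *\<^sub>K x) = c *\<^sub>K p x" "p 0 = 0" for x y c
    by (simp_all add: p_def distrib_left P.add sum.distrib P.scale scale_mult salg.scale_sum_right P.zero)
  have p_equiv: "p (h * x) = h * p x" if h: "h \<in> U" for h x
  proof -
    have "p (h * x) = (\<Sum>u\<in>U. (h * u) * P (j (h * u) * (h * x)))"
      unfolding p_def by (rule sum.reindex_bij_betw[OF bij[OF h], symmetric])
    also have "\<dots> = (\<Sum>u\<in>U. h * (u * P (j u * x)))"
      using j_mult[OF h] by (intro sum.cong) (simp_all flip: mult.assoc)
    finally show ?thesis
      by (simp add: p_def sum_distrib_left)
  qed
  have "U \<subseteq> {x. \<epsilon> * x = x \<and> p x = x * p \<epsilon>}"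
  proof
    fix u assume u: "u \<in> U"
    show "u \<in> {x. \<epsilon> * x = x \<and> p x = x * p \<epsilon>}"
      using p_equiv[OF u, of \<epsilon>] unit[OF u] by simp
  qed
  moreover have "salg.subspace {x. \<epsilon> * x = x \<and> p x = x * p \<epsilon>}"
    by (rule salg.subspaceI) (simp_all add: distrib_left distrib_right scale_mult p_lin)
  ultimately have span: "\<epsilon> * x = x \<and> p x = x * p \<epsilon>" if "x \<in> salg.span U" for x
    using salg.span_minimal that by blast
  define c where "c = inverse (of_nat (card U)) *\<^sub>K p \<epsilon>"
  have "p \<epsilon> \<in> L"
    unfolding p_def using P(1) by (intro salg.subspace_sum[OF L(1)] UL) auto
  then have c: "c \<in> L"
    unfolding c_def by (rule salg.subspace_scale[OF L(1)])
  have x_eq: "x = x * c" if x: "x \<in> L" for x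
  proof -
    have xs: "\<epsilon> * x = x" "p x = x * p \<epsilon>"
      using span x L(2) by auto
    have "u * P (j u * x) = x" if "u \<in> U" for u
      using that xs(1) j[OF that] P(3)[OF UL] x by (simp flip: mult.assoc)
    then have "p x = (\<Sum>u\<in>U. x)"
      unfolding p_def by (intro sum.cong) simp_all
    also have "\<dots> = of_nat (card U) *\<^sub>K x"
      by (rule salg.sum_constant_scale)
    finally have "x * c = inverse (of_nat (card U)) *\<^sub>K of_nat (card U) *\<^sub>K x"
      using xs(2) by (simp add: c_def scale_mult)
    then show ?thesis
      using card by simp
  qed
  then have "c = 0"
    using nilpotent_no_idempotent[OF L(3) c] c by metis
  then show ?thesis
    using x_eq by fastforce
qed

section \<open>Quotients\<close>

lemma coset_eq_iff:
  fixes x y :: "('b::{finite, semigroup_mult}, 'k::field) salg"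
  assumes "salg.subspace I"
  shows "coset x I = coset y I \<longleftrightarrow> x - y \<in> I"
proof
  assume "coset x I = coset y I"
  moreover have "x \<in> coset x I"
    using salg.subspace_0[OF assms] by (force simp: coset_def)
  ultimately show "x - y \<in> I"
    by (auto simp: coset_def)
next
  have sub: "coset x I \<subseteq> coset y I" if d: "x - y \<in> I" for x y
  proof
    fix z assume "z \<in> coset x I"
    then obtain i where i: "z = x + i" "i \<in> I" by (auto simp: coset_def)
    then have "z = y + ((x - y) + i)" "(x - y) + i \<in> I"
      using salg.subspace_add[OF assms d] by simp_all
    then show "z \<in> coset y I" unfolding coset_def by blast
  qed
  assume d: "x - y \<in> I"
  moreover have "y - x \<in> I"
    using salg.subspace_neg[OF assms d] by simp
  ultimately show "coset x I = coset y I"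
    using sub by blast
qed

lemma in_coset_iff: "y \<in> coset x I \<longleftrightarrow> y - x \<in> I" for x y :: "'b::ab_group_add"
  unfolding coset_def by (auto intro!: exI[of _ "y - x"])

text \<open>The operations on a quotient are unions of cosets over all representatives; this collapses such a
  union to a single coset.\<close>

lemma UN_coset_const:
  fixes g :: "'c \<Rightarrow> ('b::{finite, semigroup_mult}, 'k::field) salg"
  assumes "salg.subspace I" "A \<noteq> {}" "\<And>a. a \<in> A \<Longrightarrow> g a - z \<in> I"
  shows "(\<Union>a\<in>A. coset (g a) I) = coset z I"
  using assms coset_eq_iff[OF assms(1)] by blast

lemma quotient_ops:
  fixes x y :: "('b::{finite, semigroup_mult}, 'k::field) salg"
  assumes I: "algebra_ideal A I" and xy: "x \<in> A" "y \<in> A"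
  shows "q_add I (coset x I) (coset y I) = coset (x + y) I"
    and "q_mult I (coset x I) (coset y I) = coset (x * y) I"
    and "q_scale I c (coset x I) = coset (c *\<^sub>K x) I"
proof -
  have sub: "salg.subspace I" and IA: "I \<subseteq> A"
    and mult: "\<And>a i. a \<in> A \<Longrightarrow> i \<in> I \<Longrightarrow> a * i \<in> I \<and> i * a \<in> I"
    using I by (auto simp: algebra_ideal_def)
  have ne: "coset z I \<noteq> {}" for z
    using salg.subspace_0[OF sub] by (auto simp: coset_def)
  show "q_scale I c (coset x I) = coset (c *\<^sub>K x) I"
    unfolding q_scale_def
    by (rule UN_coset_const[OF sub ne])
      (simp add: in_coset_iff salg.subspace_scale[OF sub] flip: salg.scale_right_diff_distrib)
  have "q_add I X Y = (\<Union>(x, y) \<in> X \<times> Y. coset (x + y) I)"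
    "q_mult I X Y = (\<Union>(x, y) \<in> X \<times> Y. coset (x * y) I)" for X Y
    by (auto simp: q_add_def q_mult_def)
  note q = this[of "coset x I" "coset y I", unfolded case_prod_unfold]
  have ne2: "coset x I \<times> coset y I \<noteq> {}"
    using ne by simp
  show "q_add I (coset x I) (coset y I) = coset (x + y) I"
    unfolding q
  proof (rule UN_coset_const[OF sub ne2])
    fix a assume "a \<in> coset x I \<times> coset y I"
    then have "(fst a - x) + (snd a - y) \<in> I"
      by (intro salg.subspace_add[OF sub]) (auto simp: in_coset_iff)
    then show "fst a + snd a - (x + y) \<in> I"
      by (simp add: algebra_simps)
  qed
  show "q_mult I (coset x I) (coset y I) = coset (x * y) I"
    unfolding q
  proof (rule UN_coset_const[OF sub ne2])
    fix a assume "a \<in> coset x I \<times> coset y I"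
    then have d: "fst a - x \<in> I" "snd a - y \<in> I"
      by (auto simp: in_coset_iff)
    then have "(fst a - x) * (snd a - y) + ((fst a - x) * y + x * (snd a - y)) \<in> I"
      using mult xy IA by (intro salg.subspace_add[OF sub]) blast+
    then show "fst a * snd a - x * y \<in> I"
      by (simp add: algebra_simps)
  qed
qed

section \<open>The map \<open>nu\<close> in terms of floor elements\<close>

lemma down_Reg: "t \<in> down s \<Longrightarrow> t \<in> Reg"
  by (simp add: down_def)

lemma coef_floor_elt:
  "coef (floor_elt s :: ('b::{finite, semigroup_mult}, 'k::field) salg) r
    = (if (r, s) \<in> nat_le then of_int (mobius Reg nat_le r s) else 0)"
proof -
  have "(\<Sum>t \<in> {t \<in> Reg. (t, s) \<in> nat_le}.
        (of_int (mobius Reg nat_le t s) :: 'k) * (if r = t then 1 else 0))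
      = (if r \<in> {t \<in> Reg. (t, s) \<in> nat_le} then of_int (mobius Reg nat_le r s) else 0)"
    by (simp add: if_distrib[of "\<lambda>c. _ * c"] sum.delta' cong: if_cong)
  then show ?thesis
    by (simp add: floor_elt_def nat_le_def)
qed

lemma floor_elt_KR:
  "floor_elt s \<in> (KR :: ('b::{finite, semigroup_mult}, 'k::field) salg set)"
  by (auto simp: KR_def coef_floor_elt nat_le_def)

definition floor_coef :: "('b::{finite, semigroup_mult}, 'k::field) salg \<Rightarrow> 'b \<Rightarrow> 'k" where
  "floor_coef x t = (\<Sum>s | t \<in> down s. coef x s)"

text \<open>Exchanging the two summations shows that \<^const>\<open>floor_coef\<close> gives the coordinates
  of \<open>nu x\<close>.\<close>

lemma nu_eq_sum_floor: "nu x = (\<Sum>t\<in>Reg. floor_coef x t *\<^sub>K floor_elt t)"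
  for x :: "('b::{finite, semigroup_mult}, 'k::field) salg"
proof (rule salg_eqI)
  fix r
  have "coef (nu x) r = (\<Sum>s\<in>UNIV. \<Sum>t | t \<in> Reg \<and> t \<in> down s. coef x s * coef (floor_elt t) r)"
    by (auto simp: nu_def sum_distrib_left down_def intro!: sum.cong)
  also have "\<dots> = (\<Sum>t\<in>Reg. \<Sum>s | s \<in> UNIV \<and> t \<in> down s. coef x s * coef (floor_elt t) r)"
    by (rule sum.swap_restrict) auto
  finally show "coef (nu x) r = coef (\<Sum>t\<in>Reg. floor_coef x t *\<^sub>K floor_elt t) r"
    by (simp add: floor_coef_def sum_distrib_right)
qed

lemma nu_add: "nu (x + y) = nu x + nu (y :: ('b::{finite, semigroup_mult}, 'k::field) salg)"
  and nu_diff: "nu (x - y) = nu x - nu (y :: ('b::{finite, semigroup_mult}, 'k::field) salg)"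
  and nu_scale: "nu (c *\<^sub>K x) = c *\<^sub>K nu (x :: ('b::{finite, semigroup_mult}, 'k::field) salg)"
  and nu_0: "nu 0 = (0 :: ('b::{finite, semigroup_mult}, 'k::field) salg)"
  by (simp_all add: nu_def salg.scale_left_distrib salg.scale_left_diff_distrib
      sum.distrib sum_subtractf salg.scale_sum_right)

lemma nu_sum:
  "nu (\<Sum>i\<in>I. f i) = (\<Sum>i\<in>I. nu (f i :: ('b::{finite, semigroup_mult}, 'k::field) salg))"
  by (induction I rule: infinite_finite_induct) (simp_all add: nu_add nu_0)

text \<open>The product of \<open>s\<close> and \<open>t\<close> in the algebra of the groupoid whose arrows are the regular elements,
  with \<open>s\<close> running from \<open>sinv s * s\<close> to \<open>s * sinv s\<close>.\<close>

definition groupoid_mult ::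
    "'b::{finite, semigroup_mult} \<Rightarrow> 'b \<Rightarrow> ('b, 'k::field) salg" where
  "groupoid_mult s t = (if sinv s * s = t * sinv t then floor_elt (s * t) else 0)"

section \<open>Regular elements\<close>

context
  assumes comm: "\<And>e f :: 'a::{finite, semigroup_mult}.
      idempotent e \<Longrightarrow> idempotent f \<Longrightarrow> e * f = f * e"
begin

lemma sinv_eqI: "inverse_of (s :: 'a) t \<Longrightarrow> sinv s = t"
  unfolding sinv_def by (rule the_equality) (auto intro: inverse_of_unique[OF comm])

lemma sinv_inverse:
  assumes "(s :: 'a) \<in> Reg"
  shows "s * sinv s * s = s" "sinv s * s * sinv s = sinv s"
  using inverse_of_sinv[OF comm assms] by (auto simp: inverse_of_def)

lemma sinv_Reg: "(s :: 'a) \<in> Reg \<Longrightarrow> sinv s \<in> Reg" "(s :: 'a) \<in> Reg \<Longrightarrow> sinv (sinv s) = s"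
proof -
  assume "s \<in> Reg"
  then have "inverse_of (sinv s) s"
    using inverse_of_sinv[OF comm] by (auto simp: inverse_of_def)
  then show "sinv s \<in> Reg" "sinv (sinv s) = s"
    using sinv_eqI by (auto simp: Reg_def)
qed

lemma RegI: "s * x * s = s \<Longrightarrow> (s :: 'a) \<in> Reg"
  unfolding Reg_def inverse_of_def mem_Collect_eq
  by (rule exI[of _ "x * s * x"]) (metis mult.assoc)

lemma idempotent_sinv:
  assumes "(s :: 'a) \<in> Reg"
  shows "idempotent (s * sinv s)" "idempotent (sinv s * s)"
  using sinv_inverse[OF assms] by (simp_all add: idempotent_def flip: mult.assoc)

lemma idempotent_Reg: "idempotent (e :: 'a) \<Longrightarrow> e \<in> Reg" "idempotent (e :: 'a) \<Longrightarrow> sinv e = e"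
proof -
  assume "idempotent e"
  then have "inverse_of e e"
    by (simp add: idempotent_def inverse_of_def)
  then show "e \<in> Reg" "sinv e = e"
    using sinv_eqI by (auto simp: Reg_def)
qed

lemma sinv_mult:
  assumes "(s :: 'a) \<in> Reg" "u \<in> Reg"
  shows "sinv (s * u) = sinv u * sinv s"
proof -
  have c: "(u * sinv u) * (sinv s * s) = (sinv s * s) * (u * sinv u)"
    using assms idempotent_sinv by (intro comm)
  have "s * u * (sinv u * sinv s) * (s * u) = s * ((u * sinv u) * (sinv s * s)) * u"
    by (simp add: mult.assoc)
  also have "\<dots> = (s * sinv s * s) * (u * sinv u * u)"
    unfolding c by (simp add: mult.assoc)
  finally have 1: "s * u * (sinv u * sinv s) * (s * u) = s * u"
    using assms sinv_inverse by simp
  have "sinv u * sinv s * (s * u) * (sinv u * sinv s)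
      = sinv u * ((sinv s * s) * (u * sinv u)) * sinv s"
    by (simp add: mult.assoc)
  also have "\<dots> = (sinv u * u * sinv u) * (sinv s * s * sinv s)"
    unfolding c[symmetric] by (simp add: mult.assoc)
  finally have "inverse_of (s * u) (sinv u * sinv s)"
    using assms sinv_inverse 1 by (simp add: inverse_of_def)
  then show ?thesis
    by (rule sinv_eqI)
qed

text \<open>The set \<open>down s\<close> is left-right symmetric, although its definition is not: membership of
  \<open>t\<close> amounts to \<open>sinv t * s * sinv t = sinv t\<close>. In the forward direction
  \<open>s * sinv t\<close> is then an idempotent generating the same left ideal as \<open>t * sinv t\<close>, and
  commuting idempotents that generate the same left ideal are equal.\<close>

lemma down_iff_right: "(t :: 'a) \<in> down s \<longleftrightarrow> t \<in> Reg \<and> s * (sinv t * t) = t"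
proof (cases "t \<in> Reg")
  case t: True
  note inv = sinv_inverse[OF t]
  show ?thesis
  proof
    assume "t \<in> down s"
    then have "t * sinv t * s = t" by (simp add: down_def)
    then have f: "sinv t * s * sinv t = sinv t"
      using inv by (metis mult.assoc)
    then have "idempotent (s * sinv t)"
      by (simp add: idempotent_def mult.assoc)
    then have "s * sinv t * (t * sinv t) = t * sinv t * (s * sinv t)"
      using idempotent_sinv[OF t] by (intro comm)
    then have "s * sinv t = t * sinv t"
      using f inv by (simp add: mult.assoc)
    then have "s * (sinv t * t) = t"
      using inv by (simp flip: mult.assoc)
    with t show "t \<in> Reg \<and> s * (sinv t * t) = t" by simp
  next
    assume "t \<in> Reg \<and> s * (sinv t * t) = t"
    then have f: "sinv t * s * sinv t = sinv t"
      using inv by (metis mult.assoc)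
    then have "idempotent (sinv t * s)"
      by (simp add: idempotent_def flip: mult.assoc)
    then have "sinv t * s * (sinv t * t) = sinv t * t * (sinv t * s)"
      using idempotent_sinv[OF t] by (intro comm)
    then have "sinv t * t = sinv t * s"
      using f inv by (simp flip: mult.assoc)
    then have "t * sinv t * s = t"
      using inv by (simp add: mult.assoc)
    with t show "t \<in> down s" by (simp add: down_def)
  qed
qed (simp add: down_def)

lemma down_eq_nat_le:
  assumes s: "(s :: 'a) \<in> Reg"
  shows "t \<in> down s \<longleftrightarrow> (t, s) \<in> nat_le"
proof
  assume "t \<in> down s"
  then show "(t, s) \<in> nat_le"
    using s idempotent_sinv[of t]
    by (auto simp: nat_le_def down_def intro!: exI[of _ "t * sinv t"])
next
  assume "(t, s) \<in> nat_le"
  then obtain e where t: "t \<in> Reg" and e: "idempotent e" "t = e * s"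
    unfolding nat_le_def mem_Collect_eq prod.case by blast
  have "e * t = t"
    using e by (metis idempotent_def mult.assoc)
  have "t * sinv t = t * sinv t * e"
    using \<open>e * t = t\<close> comm[OF idempotent_sinv(1)[OF t] e(1)] by (simp flip: mult.assoc)
  then have "t * sinv t * s = t * sinv t * t"
    using e(2) by (metis mult.assoc)
  then show "t \<in> down s"
    using t sinv_inverse by (simp add: down_def)
qed

lemma down_refl: "(s :: 'a) \<in> Reg \<Longrightarrow> s \<in> down s"
  by (simp add: down_def sinv_inverse)

text \<open>If \<open>t\<close> and \<open>t'\<close> compose, then \<open>t * t' = t * s'\<close> has the same range
  idempotent \<open>t * sinv t\<close> as \<open>t\<close>, so the product determines \<open>t\<close> and then
  \<open>t'\<close>. Conversely \<open>u \<in> down (s * s')\<close> factors through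
  \<open>t = u * sinv u * s\<close>. This is regular even for irregular \<open>s\<close>, because its right multiple
  \<open>t * (s' * sinv u) = u * sinv u\<close> fixes \<open>t\<close> from the left.\<close>

lemma down_mult_bij:
  "bij_betw (\<lambda>(t, t'). t * t') {(t, t'). t \<in> down s \<and> t' \<in> down s' \<and> sinv t * t = t' * sinv t'}
    (down ((s :: 'a) * s'))" (is "bij_betw ?m ?C _")
proof -
  have comp: "t * t' \<in> Reg" "t * t' * sinv (t * t') = t * sinv t" "t * t' = t * s'"
    if "(t, t') \<in> ?C" for t t'
  proof -
    have t: "t \<in> Reg" "t' \<in> Reg" and st: "t * sinv t * s = t" "t' * sinv t' * s' = t'"
      and c: "sinv t * t = t' * sinv t'"
      using that by (auto simp: down_def)
    show "t * t' \<in> Reg"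
      using Reg_mult[OF comm] t by blast
    have "t * t' * (sinv t' * sinv t) = t * (t' * sinv t') * sinv t"
      by (simp add: mult.assoc)
    also have "\<dots> = t * sinv t"
      unfolding c[symmetric] using sinv_inverse[OF t(1)] by (simp flip: mult.assoc)
    finally show "t * t' * sinv (t * t') = t * sinv t"
      using sinv_mult[OF t] by simp
    have "t * s' = t * (t' * sinv t') * s'"
      unfolding c[symmetric] using sinv_inverse[OF t(1)] by (simp flip: mult.assoc)
    also have "\<dots> = t * t'"
      using st(2) by (simp add: mult.assoc)
    finally show "t * t' = t * s'" by simp
  qed
  show ?thesis
  proof (rule bij_betw_imageI)
    show "inj_on ?m ?C"
    proof (rule inj_onI, clarify)
      fix t t' r r'
      assume C: "t \<in> down s" "t' \<in> down s'" "sinv t * t = t' * sinv t'"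
        "r \<in> down s" "r' \<in> down s'" "sinv r * r = r' * sinv r'" and eq: "t * t' = r * r'"
      have "t * sinv t = r * sinv r"
        using comp(2)[of t t'] comp(2)[of r r'] C eq by simp
      moreover have "t * sinv t * s = t" "r * sinv r * s = r"
        "t' * sinv t' * s' = t'" "r' * sinv r' * s' = r'"
        using C(1,2,4,5) by (auto simp: down_def)
      ultimately have "t = r" "t' = sinv t * t * s'" "r' = sinv r * r * s'"
        using C(3,6) by metis+
      then show "t = r \<and> t' = r'" by simp
    qed
    show "?m ` ?C = down (s * s')"
    proof (intro equalityI subsetI)
      fix u assume "u \<in> ?m ` ?C"
      then obtain t t' where tt: "(t, t') \<in> ?C" and u: "u = t * t'" by auto
      have "u * sinv u * (s * s') = t * sinv t * s * s'"
        using comp(2)[OF tt] u by (simp add: mult.assoc)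
      also have "\<dots> = t * s'"
        using tt by (simp add: down_def)
      finally show "u \<in> down (s * s')"
        using comp[OF tt] u by (simp add: down_def)
    next
      fix u assume u': "u \<in> down (s * s')"
      then have u: "u \<in> Reg" "u * sinv u * (s * s') = u" by (auto simp: down_def)
      define f t where "f = u * sinv u" and "t = f * s"
      have f: "idempotent f" "f * u = u"
        using idempotent_sinv[OF u(1)] sinv_inverse[OF u(1)] by (auto simp: f_def)
      have ft: "f * t = t"
        using f by (simp add: t_def idempotent_def flip: mult.assoc)
      have ts': "t * s' = u"
        using u by (simp add: t_def f_def mult.assoc)
      then have tx: "t * (s' * sinv u) = f"
        by (simp add: f_def flip: mult.assoc)
      have t: "t \<in> Reg"
        by (rule RegI[of _ "s' * sinv u"]) (simp add: tx ft)
      have tf: "t * sinv t = f"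
      proof -
        have "f * (t * sinv t) = t * sinv t"
          using ft by (simp flip: mult.assoc)
        moreover have "t * sinv t * f = f"
          using tx sinv_inverse[OF t] by (metis mult.assoc)
        ultimately show ?thesis
          using comm[OF f(1) idempotent_sinv(1)[OF t]] by simp
      qed
      define t' where "t' = sinv t * u"
      have t': "t' \<in> Reg"
        using Reg_mult[OF comm sinv_Reg(1)[OF t] u(1)] by (simp add: t'_def)
      have "t' * sinv t' = sinv t * f * t"
        by (simp add: t'_def sinv_mult sinv_Reg t u f_def mult.assoc)
      then have c: "sinv t * t = t' * sinv t'"
        using ft by (simp add: mult.assoc)
      have "t' * sinv t' * s' = t'"
        unfolding c[symmetric] by (simp add: t'_def mult.assoc ts')
      moreover have "t * sinv t * s = t"
        using tf by (simp add: t_def)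
      moreover have "t * t' = u"
        using tf f(2) by (simp add: t'_def flip: mult.assoc)
      ultimately show "u \<in> ?m ` ?C"
        using t t' c by (intro image_eqI[of _ _ "(t, t')"]) (auto simp: down_def)
    qed
  qed
qed

lemma nat_le_order:
  shows "trans (nat_le :: ('a \<times> 'a) set)" "antisym (nat_le :: ('a \<times> 'a) set)"
    "refl_on Reg (nat_le :: ('a \<times> 'a) set)"
  using nat_le_partial_order[OF comm] by (auto simp: partial_order_on_def preorder_on_def)

lemma down_mono:
  assumes "(t :: 'a, s) \<in> nat_le"
  shows "down t \<subseteq> down s"
proof
  fix r assume "r \<in> down t"
  moreover have "t \<in> Reg" "s \<in> Reg"
    using assms by (simp_all add: nat_le_def)
  ultimately show "r \<in> down s"
    using down_eq_nat_le transD[OF nat_le_order(1) _ assms] by blast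
qed

lemma down_antisym:
  assumes "t \<in> Reg" "s \<in> Reg" "t \<in> down (s :: 'a)" "s \<in> down t"
  shows "s = t"
  using assms down_eq_nat_le antisymD[OF nat_le_order(2)] by blast

lemma down_psubset:
  assumes "(t :: 'a, s) \<in> nat_le" "t \<noteq> s"
  shows "down t \<subset> down s"
proof -
  have "s \<in> Reg" "t \<in> Reg" using assms(1) by (simp_all add: nat_le_def)
  then have "s \<in> down s" "s \<notin> down t"
    using down_refl down_antisym[of t s] assms down_eq_nat_le by auto
  then show ?thesis using down_mono[OF assms(1)] by blast
qed

section \<open>The basis of floor elements\<close>

text \<open>The recursion for the Moebius function runs over the second argument, which is the variable summed
  here.\<close>

lemma mobius_sum:
  assumes rs: "(r :: 'a, s) \<in> nat_le"
  shows "(\<Sum>t \<in> {t \<in> Reg. (r, t) \<in> nat_le \<and> (t, s) \<in> nat_le}. mobius Reg nat_le r t)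
    = (if r = s then 1 else 0)"
proof -
  note po = nat_le_partial_order[OF comm] and as = nat_le_order(2) and rf = nat_le_order(3)
  have s: "s \<in> Reg" "(s, s) \<in> nat_le"
    using rs rf by (auto simp: nat_le_def refl_on_def)
  show ?thesis
  proof (cases "r = s")
    case True
    have "{t \<in> Reg. (s, t) \<in> nat_le \<and> (t, s) \<in> nat_le} = {s}"
      using s as by (auto dest: antisymD)
    then show ?thesis
      using True s po by (simp add: mobius.simps[of _ _ s s])
  next
    case False
    let ?A = "{t \<in> Reg. (r, t) \<in> nat_le \<and> (t, s) \<in> nat_le}"
    have "(\<Sum>t\<in>?A. mobius Reg nat_le r t)
        = mobius Reg nat_le r s + (\<Sum>t\<in>?A - {s}. mobius Reg nat_le r t)"
      using rs s by (intro sum.remove) auto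
    also have "?A - {s} = {t \<in> Reg. (r, t) \<in> nat_le \<and> (t, s) \<in> nat_le \<and> t \<noteq> s}"
      by blast
    finally show ?thesis
      using False rs po by (simp add: mobius.simps[of _ _ r s])
  qed
qed

lemma sum_floor_elt_down:
  assumes s: "(s :: 'a) \<in> Reg"
  shows "(\<Sum>t\<in>down s. floor_elt t) = (single s :: ('a, 'k::field) salg)"
proof (rule salg_eqI)
  fix r
  let ?A = "{t \<in> Reg. (r, t) \<in> nat_le \<and> (t, s) \<in> nat_le}"
  have A: "{t \<in> down s. (r, t) \<in> nat_le} = ?A"
    using down_eq_nat_le[OF s] by (auto simp: down_def)
  have "coef (\<Sum>t\<in>down s. floor_elt t :: ('a, 'k) salg) r
      = of_int (\<Sum>t\<in>?A. mobius Reg nat_le r t)"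
    by (simp add: coef_floor_elt sum.If_cases Int_def A)
  also have "\<dots> = (if r = s then 1 else 0)"
  proof (cases "(r, s) \<in> nat_le")
    case True
    then show ?thesis by (simp add: mobius_sum del: of_int_sum)
  next
    case False
    then have "?A = {}" "r \<noteq> s"
      using nat_le_order(1,3) s by (auto simp: refl_on_def dest: transD)
    then show ?thesis by (simp del: Collect_empty_eq)
  qed
  finally show "coef (\<Sum>t\<in>down s. floor_elt t :: ('a, 'k) salg) r = coef (single s) r"
    by simp
qed

text \<open>The floor elements are unitriangular with respect to the basis of regular elements: at
  \<open>t\<close>, only \<open>floor_elt u\<close> with \<open>t \<le> u\<close> contributes. The
  induction therefore descends from the maximal elements.\<close>

lemma floor_elt_independent:
  fixes c :: "'a \<Rightarrow> 'k::field"
  assumes 0: "(\<Sum>t\<in>Reg. c t *\<^sub>K floor_elt t) = 0" and t: "t \<in> Reg"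
  shows "c t = 0"
  using t
proof (induction "card (UNIV :: 'a set) - card (down t)" arbitrary: t rule: less_induct)
  case less
  have above: "c u = 0" if u: "u \<in> Reg" "(t, u) \<in> nat_le" "t \<noteq> u" for u
  proof -
    have "card (down t) < card (down u)" "card (down u) \<le> card (UNIV :: 'a set)"
      using down_psubset[OF u(2,3)] by (simp_all add: psubset_card_mono card_mono)
    then show ?thesis
      using less.hyps[OF _ u(1)] by simp
  qed
  have t: "(t, t) \<in> nat_le" "partial_order_on Reg (nat_le :: ('a \<times> 'a) set)"
    using down_refl[OF less.prems] down_eq_nat_le[OF less.prems] nat_le_partial_order[OF comm]
    by auto
  have "0 = (\<Sum>u\<in>Reg. c u * coef (floor_elt u) t)"
    using arg_cong[OF 0, of "\<lambda>x. coef x t"] by simp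
  also have "\<dots> = (\<Sum>u\<in>Reg. if u = t then c t else 0)"
    using above t by (intro sum.cong) (auto simp: coef_floor_elt mobius.simps[of _ _ t t])
  finally show ?case
    using less.prems by simp
qed

lemma nu_eq_0_iff: "nu x = 0 \<longleftrightarrow> (\<forall>t\<in>Reg. floor_coef x t = 0)"
  for x :: "('a, 'k::field) salg"
  using floor_elt_independent[of "floor_coef x"] by (auto simp: nu_eq_sum_floor)

lemma subspace_KR: "salg.subspace (KR :: ('a, 'k::field) salg set)"
  by (rule subalgebra_KR[OF comm, unfolded subalgebra_def, THEN conjunct1])

lemma nu_KR: "nu x \<in> KR" for x :: "('a, 'k::field) salg"
  unfolding nu_eq_sum_floor
  by (intro salg.subspace_sum salg.subspace_scale subspace_KR floor_elt_KR)

lemma nu_id: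
  fixes x :: "('a, 'k::field) salg"
  assumes "x \<in> KR"
  shows "nu x = x"
proof -
  have "coef x s *\<^sub>K (\<Sum>t\<in>down s. floor_elt t) = coef x s *\<^sub>K single s" for s
    using assms sum_floor_elt_down[of s] by (cases "s \<in> Reg") (auto simp: KR_def)
  then have "nu x = (\<Sum>s\<in>UNIV. coef x s *\<^sub>K single s)"
    by (simp only: nu_def)
  then show ?thesis
    by (simp only: salg_expand[symmetric])
qed

text \<open>Functions of two arguments are determined by their sums over products of order ideals. This
  replaces an explicit computation with the Moebius function in the product rule for floor
  elements.\<close>

lemma zeta_inversion:
  fixes f g :: "'a \<Rightarrow> 'a \<Rightarrow> 'b::ab_group_add"
  assumes eq: "\<And>s t. s \<in> Reg \<Longrightarrow> t \<in> Reg \<Longrightarrow>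
      (\<Sum>(a, b)\<in>down s \<times> down t. f a b) = (\<Sum>(a, b)\<in>down s \<times> down t. g a b)"
    and "s \<in> Reg" "t \<in> Reg"
  shows "f s t = g s t"
  using assms(2,3)
proof (induction "card (down s \<times> down t)" arbitrary: s t rule: less_induct)
  case less
  let ?D = "down s \<times> down t"
  have st: "(s, t) \<in> ?D"
    using less.prems down_refl by auto
  have "f a b = g a b" if ab: "(a, b) \<in> ?D - {(s, t)}" for a b
  proof -
    have "a \<in> Reg" "b \<in> Reg"
      using ab down_Reg by auto
    moreover have "down a \<times> down b \<subset> ?D"
    proof -
      have "down a \<subseteq> down s" "down b \<subseteq> down t"
        using ab less.prems down_eq_nat_le down_mono by auto
      moreover have "(s, t) \<notin> down a \<times> down b"
        using ab down_antisym down_Reg less.prems by blast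
      ultimately show ?thesis
        using st by blast
    qed
    ultimately show ?thesis
      using less.hyps[of a b] psubset_card_mono[of ?D "down a \<times> down b"] by simp
  qed
  then have "(\<Sum>(a, b)\<in>?D - {(s, t)}. f a b) = (\<Sum>(a, b)\<in>?D - {(s, t)}. g a b)"
    by (intro sum.cong) auto
  moreover have "(\<Sum>(a, b)\<in>?D. h a b) = h s t + (\<Sum>(a, b)\<in>?D - {(s, t)}. h a b)"
    for h :: "'a \<Rightarrow> 'a \<Rightarrow> 'b"
    using sum.remove[of ?D "(s, t)" "case_prod h"] st by simp
  ultimately show ?case
    using eq[OF less.prems] by simp
qed

lemma sum_groupoid_mult:
  "(\<Sum>(a, b)\<in>down s \<times> down t. groupoid_mult a b)
    = (\<Sum>u\<in>down (s * t). floor_elt u :: ('a, 'k::field) salg)"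
proof -
  let ?C = "{(a, b). a \<in> down s \<and> b \<in> down t \<and> sinv a * a = b * sinv b}"
  have "(\<Sum>(a, b)\<in>down s \<times> down t. groupoid_mult a b :: ('a, 'k) salg)
      = (\<Sum>(a, b)\<in>?C. floor_elt (a * b))"
    by (rule sum.mono_neutral_cong_right) (auto simp: groupoid_mult_def split: if_splits)
  also have "\<dots> = (\<Sum>p\<in>?C. floor_elt ((\<lambda>(a, b). a * b) p))"
    by (simp add: case_prod_unfold)
  also have "\<dots> = (\<Sum>u\<in>down (s * t). floor_elt u)"
    by (rule sum.reindex_bij_betw[OF down_mult_bij])
  finally show ?thesis .
qed

text \<open>By \<open>zeta_inversion\<close> it suffices to compare sums over \<open>down s \<times> down t\<close>; on both sides
  they are \<open>single (s * t)\<close>.\<close>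

lemma floor_elt_mult:
  assumes "s \<in> Reg" "t \<in> Reg"
  shows "floor_elt s * floor_elt t = (groupoid_mult s t :: ('a, 'k::field) salg)"
  using _ assms
proof (rule zeta_inversion)
  fix s t :: 'a assume st: "s \<in> Reg" "t \<in> Reg"
  have "(\<Sum>(a, b)\<in>down s \<times> down t. floor_elt a * floor_elt b :: ('a, 'k) salg)
      = (\<Sum>a\<in>down s. floor_elt a) * (\<Sum>b\<in>down t. floor_elt b)"
    by (simp add: sum_product sum.cartesian_product)
  also have "\<dots> = single (s * t)"
    using st by (simp add: sum_floor_elt_down single_mult)
  also have "\<dots> = (\<Sum>u\<in>down (s * t). floor_elt u)"
    using Reg_mult[OF comm st] by (simp add: sum_floor_elt_down)
  finally show "(\<Sum>(a, b)\<in>down s \<times> down t. floor_elt a * floor_elt b :: ('a, 'k) salg)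
      = (\<Sum>(a, b)\<in>down s \<times> down t. groupoid_mult a b)"
    by (simp add: sum_groupoid_mult)
qed

text \<open>The product rule applies to all members of \<open>down s\<close> and \<open>down t\<close>, since
  these are regular even when \<open>s\<close> and \<open>t\<close> are not.\<close>

lemma nu_mult_single:
  "nu (single s * single t) = nu (single s) * (nu (single t) :: ('a, 'k::field) salg)"
proof -
  have "nu (single s) * (nu (single t) :: ('a, 'k) salg)
      = (\<Sum>(a, b)\<in>down s \<times> down t. floor_elt a * floor_elt b)"
    by (simp add: nu_single sum_product sum.cartesian_product)
  also have "\<dots> = (\<Sum>(a, b)\<in>down s \<times> down t. groupoid_mult a b)"
    using down_Reg by (intro sum.cong) (auto intro: floor_elt_mult)
  finally show ?thesis
    by (simp add: sum_groupoid_mult single_mult nu_single)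
qed

lemma nu_mult: "nu (x * y) = nu x * nu (y :: ('a, 'k::field) salg)"
proof -
  have "x * y = (\<Sum>s\<in>UNIV. \<Sum>t\<in>UNIV. coef x s *\<^sub>K coef y t *\<^sub>K (single s * single t))"
    by (subst salg_expand[of x], subst salg_expand[of y])
      (simp add: sum_product scale_mult mult.commute)
  then have "nu (x * y)
      = (\<Sum>s\<in>UNIV. \<Sum>t\<in>UNIV. coef x s *\<^sub>K coef y t *\<^sub>K (nu (single s) * nu (single t)))"
    by (simp add: nu_sum nu_scale nu_mult_single)
  also have "\<dots> = (\<Sum>s\<in>UNIV. coef x s *\<^sub>K nu (single s)) * (\<Sum>t\<in>UNIV. coef y t *\<^sub>K nu (single t))"
    by (simp add: sum_product scale_mult mult.commute)
  finally show ?thesis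
    by (simp only: nu_single nu_def[symmetric])
qed

section \<open>Nilpotency of the kernel\<close>

text \<open>If \<open>u = u * e\<close> generates an ideal containing \<open>e\<close>, stability makes
  \<open>u\<close> regular with \<open>sinv u * u = e\<close>. The coefficient at \<open>u\<close>
  then sums over \<open>{s. u \<in> down s}\<close>, and this is a coordinate of \<open>nu
  x\<close>.\<close>

lemma kernel_mult_idempotent:
  fixes x :: "('a, 'k::field) salg"
  assumes x: "nu x = 0" and e: "idempotent e"
  shows "x * single e \<in> supported_on {u. u * e = u \<and> e \<notin> idem_below u}"
proof -
  have "coef (x * single e) u = 0" if u: "\<not> (u * e = u \<and> e \<notin> idem_below u)" for u
  proof (cases "u * e = u")
    case False
    then have "{s. s * e = u} = {}"
      using e by (auto simp: idempotent_def mult.assoc)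
    then show ?thesis
      unfolding coef_mult_single by simp
  next
    case True
    then obtain p q where "e = p * u * q"
      using u by (auto simp: idem_below_def)
    then obtain v where v: "e = v * u"
      using stability True by blast
    have "inverse_of u (v * u * v)"
      using v True e unfolding inverse_of_def idempotent_def by (metis mult.assoc)
    then have "sinv u = v * u * v" "u \<in> Reg"
      using sinv_eqI by (auto simp: Reg_def)
    then have "u \<in> Reg" "sinv u * u = e"
      using v e by (simp_all add: idempotent_def mult.assoc)
    then have "{s. s * e = u} = {s. u \<in> down s}"
      using down_iff_right by auto
    then show ?thesis
      using x \<open>u \<in> Reg\<close> by (simp add: coef_mult_single floor_coef_def nu_eq_0_iff)
  qed
  then show ?thesis
    unfolding supported_on_def by blast
qed

text \<open>A product \<open>s\<close> of many elements of level \<open>Suc k\<close> contains an idempotent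
  \<open>e\<close> of that level. Since the kernel is an ideal, the part of \<open>s\<close> to
  the left of \<open>e\<close> is absorbed into it, and multiplying by \<open>e\<close> loses at
  least the idempotent \<open>e\<close>.\<close>

lemma kernel_mult_low:
  fixes x z :: "('a, 'k::field) salg"
  assumes x: "nu x = 0" and z: "z \<in> supported_on (products (low (Suc k)) (card (UNIV :: 'a set)))"
  shows "x * z \<in> supported_on (low k)"
  using z
proof (rule mult_in_supported_on)
  fix s :: 'a assume "s \<in> products (low (Suc k)) (card (UNIV :: 'a set))"
  then obtain a e b where e: "idempotent e" "e \<in> low (Suc k)" and s: "s = a * e * b"
    using long_product_contains_idempotent[of "low (Suc k)" s] low_mult by blast
  let ?U = "{u. u * e = u \<and> e \<notin> idem_below u}"
  have "nu (x * single a) = 0"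
    using x by (simp add: nu_mult)
  then have "x * single a * single e \<in> supported_on ?U"
    using e by (intro kernel_mult_idempotent)
  moreover have "?U \<subseteq> low k"
  proof
    fix u assume u: "u \<in> ?U"
    then have "idem_below u \<subseteq> idem_below e"
      using idem_below_mult(1)[of u e] by simp
    then have "idem_below u \<subset> idem_below e"
      using u idempotent_in_idem_below[OF e(1)] by blast
    then have "card (idem_below u) < card (idem_below e)"
      by (intro psubset_card_mono) simp_all
    then show "u \<in> low k"
      using e(2) by (simp add: low_def)
  qed
  ultimately have "x * single a * single e \<in> supported_on (low k)"
    by (auto simp: supported_on_def)
  moreover have "single b \<in> supported_on (UNIV :: 'a set)"
    by (simp add: supported_on_def)
  ultimately have "x * single a * single e * single b \<in> supported_on {u * c | u c. u \<in> low k \<and> c \<in> UNIV}"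
    by (rule supported_on_mult)
  moreover have "{u * c | u c. u \<in> low k \<and> c \<in> UNIV} \<subseteq> (low k :: 'a set)"
    by (auto simp: low_mult)
  ultimately have "x * single a * single e * single b \<in> supported_on (low k)"
    unfolding supported_on_def by blast
  then show "x * single s \<in> supported_on (low k)"
    by (simp add: s single_mult mult.assoc)
qed

text \<open>If a power of the kernel is supported on level \<open>Suc k\<close>, then a higher power is supported on level
  \<open>k\<close>; level \<open>0\<close> is empty.\<close>

lemma nilpotent_kernel: "nilpotent {x :: ('a, 'k::field) salg. nu x = 0}"
proof -
  let ?N = "{x :: ('a, 'k) salg. nu x = 0}"
  have "nilpotent ?N" if "products ?N m \<subseteq> supported_on (low k)" for m k
    using that
  proof (induction k arbitrary: m)
    case 0
    have "supported_on (low 0) \<subseteq> {0 :: ('a, 'k) salg}"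
      by (auto simp: supported_on_def low_def intro: salg_eqI)
    then show ?case
      using 0 unfolding nilpotent_def by blast
  next
    case (Suc k)
    let ?n = "card (UNIV :: 'a set)"
    obtain m' where "products ?N m' \<subseteq> products (products ?N m) ?n"
      using products_products by blast
    also have "\<dots> \<subseteq> products (supported_on (low (Suc k))) ?n"
      by (rule products_mono[OF Suc.prems])
    also have "\<dots> \<subseteq> supported_on (products (low (Suc k)) ?n)"
      by (rule products_supported_on)
    finally have "products ?N (Suc m') \<subseteq> supported_on (low k)"
      using kernel_mult_low by auto
    then show ?case
      by (rule Suc.IH)
  qed
  moreover have "products ?N 0 \<subseteq> supported_on (low (Suc (card (UNIV :: 'a set))))"
    by (auto simp: supported_on_def low_def less_Suc_eq_le card_mono)
  ultimately show ?thesis .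
qed

section \<open>Semisimplicity of the algebra of regular elements\<close>

text \<open>The maximal subgroup at \<open>e\<close> consists of the loops at \<open>e\<close> in the groupoid
  of regular elements.\<close>

lemma unit_group_eq:
  assumes e: "idempotent (e :: 'a)"
  shows "unit_group e = {g \<in> Reg. g * sinv g = e \<and> sinv g * g = e}"
proof (intro equalityI subsetI)
  fix g assume "g \<in> unit_group e"
  then obtain s s' where g: "g = e * s * e" and y: "g * (e * s' * e) = e" "e * s' * e * g = e"
    unfolding unit_group_def by auto
  have "inverse_of g (e * s' * e)"
    using y e by (simp add: inverse_of_def g idempotent_def mult.assoc)
      (metis idempotent_def e mult.assoc)
  then have "sinv g = e * s' * e" "g \<in> Reg"
    using sinv_eqI by (auto simp: Reg_def)
  then show "g \<in> {g \<in> Reg. g * sinv g = e \<and> sinv g * g = e}"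
    using y by simp
next
  fix g assume "g \<in> {g \<in> Reg. g * sinv g = e \<and> sinv g * g = e}"
  then have g: "g \<in> Reg" "g * sinv g = e" "sinv g * g = e" by auto
  then have "g = e * g * e" "sinv g = e * sinv g * e"
    using sinv_inverse[OF g(1)] by (metis mult.assoc)+
  then show "g \<in> unit_group e"
    using g(2,3) unfolding unit_group_def by blast
qed

lemma inj_floor_elt: "inj_on (floor_elt :: 'a \<Rightarrow> ('a, 'k::field) salg) Reg"
proof (rule inj_onI)
  have below: "(s, t) \<in> nat_le"
    if "s \<in> Reg" "floor_elt s = (floor_elt t :: ('a, 'k) salg)" for s t :: 'a
  proof -
    have "(s, s) \<in> nat_le"
      using that(1) nat_le_order(3) by (auto simp: refl_on_def)
    then have "coef (floor_elt s :: ('a, 'k) salg) s = 1"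
      using nat_le_partial_order[OF comm] by (simp add: coef_floor_elt mobius.simps[of _ _ s s])
    then have "coef (floor_elt t :: ('a, 'k) salg) s = 1"
      by (simp add: that(2))
    then show ?thesis
      by (simp add: coef_floor_elt split: if_splits)
  qed
  fix s t :: 'a
  assume "s \<in> Reg" "t \<in> Reg" "floor_elt s = (floor_elt t :: ('a, 'k) salg)"
  then show "s = t"
    using below[of s t] below[of t s] antisymD[OF nat_le_order(2)] by simp
qed

lemma unit_group_mult:
  assumes e: "idempotent (e :: 'a)" and gh: "g \<in> unit_group e" "h \<in> unit_group e"
  shows "g * h \<in> unit_group e"
proof -
  note G = unit_group_eq[OF e]
  have r: "g \<in> Reg" "h \<in> Reg" "g * h \<in> Reg"
    and g: "g * sinv g = e" "sinv g * g = e" and h: "h * sinv h = e" "sinv h * h = e"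
    using gh Reg_mult[OF comm] by (auto simp: G)
  have "g * h * (sinv h * sinv g) = g * (h * sinv h) * sinv g"
    by (simp add: mult.assoc)
  also have "\<dots> = g * sinv g * g * sinv g"
    by (simp add: g(2) h(1) mult.assoc)
  also have "\<dots> = e"
    using sinv_inverse[OF r(1)] g by simp
  finally have 1: "g * h * (sinv h * sinv g) = e" .
  have "sinv h * sinv g * (g * h) = sinv h * (sinv g * g) * h"
    by (simp add: mult.assoc)
  also have "\<dots> = sinv h * h * sinv h * h"
    by (simp add: g(2) h(1) mult.assoc)
  also have "\<dots> = e"
    using sinv_inverse[OF r(2)] h by simp
  finally show ?thesis
    using 1 r sinv_mult by (simp add: G)
qed

lemma group_ring_no_nilpotent:
  fixes L :: "('a, 'k::field) salg set"
  assumes e: "idempotent e" and card: "of_nat (card (unit_group e)) \<noteq> (0 :: 'k)"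
    and L: "salg.subspace L" "L \<subseteq> salg.span (floor_elt ` unit_group e)" "nilpotent L"
    and GL: "\<And>g x. g \<in> unit_group e \<Longrightarrow> x \<in> L \<Longrightarrow> floor_elt g * x \<in> L"
  shows "L \<subseteq> {0}"
proof -
  let ?G = "unit_group e"
  let ?U = "floor_elt ` ?G :: ('a, 'k) salg set"
  note G = unit_group_eq[OF e]
  have ee: "e * e = e" using e by (simp add: idempotent_def)
  have eG: "e \<in> ?G"
    using e idempotent_Reg[OF e] by (simp add: G ee)
  have eg: "e * g = g" "g * e = g" if "g \<in> ?G" for g
    using that sinv_inverse[of g] by (auto simp: G mult.assoc)
  have mult: "floor_elt g * floor_elt h = (floor_elt (g * h) :: ('a, 'k) salg)"
    if "g \<in> ?G" "h \<in> ?G" for g h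
    using that floor_elt_mult[of g h] by (auto simp: G groupoid_mult_def)
  note closed = unit_group_mult[OF e]
  have inv: "sinv g \<in> ?G" if "g \<in> ?G" for g
    using that sinv_Reg by (auto simp: G)
  show ?thesis
  proof (rule nilpotent_left_ideal_of_group_span[where U = ?U and \<epsilon> = "floor_elt e"])
    show "floor_elt e \<in> ?U" using eG by blast
    show "u * v \<in> ?U" if "u \<in> ?U" "v \<in> ?U" for u v
      using that closed mult by auto
    show "floor_elt e * u = u \<and> u * floor_elt e = u" if "u \<in> ?U" for u
      using that eG mult eg by auto
    show "\<exists>v\<in>?U. v * u = floor_elt e \<and> u * v = floor_elt e" if "u \<in> ?U" for u
    proof -
      obtain g where g: "g \<in> ?G" "u = floor_elt g" using \<open>u \<in> ?U\<close> by blast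
      have "floor_elt (sinv g) * u = floor_elt e" "u * floor_elt (sinv g) = floor_elt e"
        using g mult inv by (auto simp: G)
      then show ?thesis using inv g(1) by blast
    qed
    have "?G \<subseteq> Reg" by (auto simp: G)
    then show "of_nat (card ?U) \<noteq> (0 :: 'k)"
      using card card_image[OF inj_on_subset[OF inj_floor_elt]] by metis
  qed (use L GL in auto)
qed

text \<open>Let \<open>t\<close> be an arrow from \<open>e\<close> to \<open>f\<close>. Cutting
  \<open>x\<close> by \<open>floor_elt f\<close> and \<open>floor_elt e\<close> keeps exactly the
  arrows from \<open>e\<close> to \<open>f\<close>, and translation by \<open>floor_elt (sinv
  t)\<close> turns these into loops at \<open>e\<close>. The result lies in the group algebra at
  \<open>e\<close> and in the ideal, so it vanishes; translating back by \<open>floor_elt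
  t\<close>, the coordinate of \<open>x\<close> at \<open>t\<close> vanishes.\<close>

lemma nilpotent_ideal_KR_trivial:
  fixes J :: "('a, 'k::field) salg set"
  assumes J: "algebra_ideal KR J" "nilpotent J"
    and card: "\<And>e :: 'a. idempotent e \<Longrightarrow> of_nat (card (unit_group e)) \<noteq> (0 :: 'k)"
  shows "J \<subseteq> {0}"
proof
  fix x assume x: "x \<in> J"
  have sub: "salg.subspace J" and JKR: "J \<subseteq> KR"
    and JJ: "\<And>a i. a \<in> KR \<Longrightarrow> i \<in> J \<Longrightarrow> a * i \<in> J \<and> i * a \<in> J"
    using J(1) by (auto simp: algebra_ideal_def)
  have x_eq: "x = (\<Sum>r\<in>Reg. floor_coef x r *\<^sub>K floor_elt r)"
    using nu_id[of x] x JKR by (auto simp: nu_eq_sum_floor)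
  have "floor_coef x t = 0" if t: "t \<in> Reg" for t
  proof -
    define e f where "e = sinv t * t" and "f = t * sinv t"
    have ef: "idempotent e" "idempotent f"
      using idempotent_sinv[OF t] by (simp_all add: e_def f_def)
    note efR = idempotent_Reg[OF ef(1)] idempotent_Reg[OF ef(2)]
    have ee: "e * e = e" "f * f = f"
      using ef by (simp_all add: idempotent_def)
    let ?H = "{r \<in> Reg. r * sinv r = f \<and> sinv r * r = e}"
    let ?U = "floor_elt ` unit_group e :: ('a, 'k) salg set"
    have t': "sinv t \<in> Reg" "sinv (sinv t) = t"
      using sinv_Reg[OF t] by auto
    have "floor_elt f * floor_elt r * floor_elt e = (if r \<in> ?H then floor_elt r else 0 :: ('a, 'k) salg)"
      if r: "r \<in> Reg" for r
    proof (cases "r * sinv r = f")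
      case True
      then have "floor_elt f * floor_elt r = (floor_elt r :: ('a, 'k) salg)"
        using floor_elt_mult[of f r] sinv_inverse[OF r] efR r
        by (auto simp: groupoid_mult_def ee)
      moreover have "r * e = r" if "sinv r * r = e"
        using that sinv_inverse[OF r] by (auto simp: mult.assoc)
      ultimately show ?thesis
        using floor_elt_mult[of r e] r efR True by (auto simp: groupoid_mult_def ee)
    next
      case False
      then have "floor_elt f * floor_elt r = (0 :: ('a, 'k) salg)"
        using floor_elt_mult[of f r] r efR by (auto simp: groupoid_mult_def ee)
      then show ?thesis
        using False by simp
    qed
    note sandwich = this
    define z where "z = floor_elt f * x * floor_elt e"
    have "z = (\<Sum>r\<in>Reg. floor_coef x r *\<^sub>K (floor_elt f * floor_elt r * floor_elt e))"
      unfolding z_def by (subst x_eq) (simp add: sum_distrib_left sum_distrib_right scale_mult)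
    also have "\<dots> = (\<Sum>r\<in>Reg. (if r \<in> ?H then floor_coef x r else 0) *\<^sub>K floor_elt r)"
      using sandwich by (intro sum.cong) auto
    finally have z: "z = (\<Sum>r\<in>Reg. (if r \<in> ?H then floor_coef x r else 0) *\<^sub>K floor_elt r)" .
    have zJ: "z \<in> J"
      unfolding z_def using JJ x floor_elt_KR by blast
    have shift: "floor_elt (sinv t) * floor_elt r \<in> ?U" if r: "r \<in> ?H" for r
    proof -
      have rR: "r \<in> Reg" and rr: "r * sinv r = t * sinv t" "sinv r * r = sinv t * t"
        using r by (auto simp: e_def f_def)
      have p: "sinv t * r \<in> Reg" "sinv (sinv t * r) = sinv r * t"
        using Reg_mult[OF comm t'(1) rR] sinv_mult[OF t'(1) rR] t'(2) by auto
      have "sinv t * r * (sinv r * t) = sinv t * (r * sinv r) * t"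
        "sinv r * t * (sinv t * r) = sinv r * (t * sinv t) * r"
        by (simp_all add: mult.assoc)
      moreover have "sinv t * (r * sinv r) * t = e"
        unfolding rr(1) using sinv_inverse[OF t] by (simp add: e_def flip: mult.assoc)
      moreover have "sinv r * (t * sinv t) * r = e"
        unfolding rr(1)[symmetric] e_def rr(2)[symmetric]
        using sinv_inverse[OF rR] by (simp flip: mult.assoc)
      ultimately have "sinv t * r \<in> unit_group e"
        using p by (simp add: unit_group_eq[OF ef(1)])
      moreover have "floor_elt (sinv t) * floor_elt r = (floor_elt (sinv t * r) :: ('a, 'k) salg)"
        using floor_elt_mult[OF t'(1) rR] rr t'(2) by (simp add: groupoid_mult_def)
      ultimately show ?thesis by simp
    qed
    define L where "L = J \<inter> salg.span ?U"
    have "L \<subseteq> {0}"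
    proof (rule group_ring_no_nilpotent[OF ef(1) card[OF ef(1)]])
      show "salg.subspace L"
        unfolding L_def by (intro salg.subspace_inter sub salg.subspace_span)
      show "L \<subseteq> salg.span ?U" by (simp add: L_def)
      have "products L n \<subseteq> products J n" for n
        by (rule products_mono) (simp add: L_def)
      then show "nilpotent L"
        using J(2) unfolding nilpotent_def by blast
      fix g y assume g: "g \<in> unit_group e" and y: "y \<in> L"
      have "?U \<subseteq> {y. floor_elt g * y \<in> salg.span ?U}"
      proof
        fix u assume "u \<in> ?U"
        then obtain h where h: "h \<in> unit_group e" "u = floor_elt h" by blast
        have r: "g \<in> Reg" "h \<in> Reg" "sinv g * g = e" "h * sinv h = e" "g * sinv g = e" "sinv h * h = e"
          using g h by (auto simp: unit_group_eq[OF ef(1)])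
        have "g * h \<in> unit_group e"
          by (rule unit_group_mult[OF ef(1) g h(1)])
        then show "u \<in> {y. floor_elt g * y \<in> salg.span ?U}"
          using floor_elt_mult[OF r(1,2)] r h(2) by (auto simp: groupoid_mult_def intro: salg.span_base)
      qed
      moreover have "salg.subspace {y. floor_elt g * y \<in> salg.span ?U}"
        by (rule salg.subspaceI)
          (auto simp: distrib_left scale_mult intro: salg.span_add salg.span_scale salg.span_zero)
      ultimately have "floor_elt g * y \<in> salg.span ?U"
        using y salg.span_minimal unfolding L_def by blast
      then show "floor_elt g * y \<in> L"
        using y JJ by (simp add: L_def floor_elt_KR)
    qed
    moreover have "floor_elt (sinv t) * z \<in> L"
    proof -
      have "floor_elt (sinv t) * z
          = (\<Sum>r\<in>Reg. (if r \<in> ?H then floor_coef x r else 0) *\<^sub>K (floor_elt (sinv t) * floor_elt r))"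
        by (simp add: z sum_distrib_left scale_mult)
      also have "\<dots> \<in> salg.span ?U"
      proof (rule salg.span_sum)
        fix r :: 'a
        show "(if r \<in> ?H then floor_coef x r else 0) *\<^sub>K (floor_elt (sinv t) * floor_elt r) \<in> salg.span ?U"
          using shift[of r] by (auto intro: salg.span_scale salg.span_base salg.span_zero)
      qed
      finally show ?thesis
        using zJ JJ by (simp add: L_def floor_elt_KR)
    qed
    ultimately have "floor_elt (sinv t) * z = 0"
      by blast
    then have "floor_elt t * floor_elt (sinv t) * z = 0"
      by (simp add: mult.assoc)
    moreover have "floor_elt t * floor_elt (sinv t) = (floor_elt f :: ('a, 'k) salg)"
      using floor_elt_mult[OF t t'(1)] t'(2) by (simp add: groupoid_mult_def f_def)
    moreover have "floor_elt f * floor_elt f = (floor_elt f :: ('a, 'k) salg)"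
      using floor_elt_mult[of f f] efR ee by (simp add: groupoid_mult_def)
    then have "floor_elt f * z = z"
      by (simp add: z_def flip: mult.assoc)
    ultimately have "z = 0"
      by simp
    then have "(if t \<in> ?H then floor_coef x t else 0) = 0"
      unfolding z by (rule floor_elt_independent[OF _ t])
    moreover have "t \<in> ?H"
      using t by (simp add: e_def f_def)
    ultimately show ?thesis by simp
  qed
  then show "x \<in> {0}"
    using x_eq by simp
qed

section \<open>The radical\<close>

lemma products_image_nu: "nu ` products I n = products (nu ` I :: ('a, 'k::field) salg set) n"
proof (induction n)
  case (Suc n)
  have "nu ` products I (Suc n) = {nu x * nu y | x y. x \<in> I \<and> y \<in> products I n}"
    unfolding products.simps by (auto simp flip: nu_mult)
  also have "\<dots> = {x * y | x y. x \<in> nu ` I \<and> y \<in> nu ` products I n}"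
    by blast
  finally show ?case
    by (simp only: Suc products.simps)
qed simp

text \<open>The image of the radical is a nilpotent ideal because \<open>nu\<close> maps onto the subalgebra. The preimage
  of a nilpotent ideal is nilpotent because a power of it lies in the nilpotent kernel.\<close>

lemma Rad_iff_nu: "x \<in> Rad UNIV \<longleftrightarrow> nu x \<in> Rad KR" for x :: "('a, 'k::field) salg"
proof
  let ?R = "Rad UNIV :: ('a, 'k) salg set" and ?R' = "Rad KR :: ('a, 'k) salg set"
  note R = Rad_largest[OF subalgebra_UNIV[where ?'a = 'a and ?'b = 'k]]
  note R' = Rad_largest[OF subalgebra_KR[OF comm, where ?'k = 'k]]
  {
    assume "x \<in> ?R"
    have I: "salg.subspace ?R" "\<And>a i. i \<in> ?R \<Longrightarrow> a * i \<in> ?R \<and> i * a \<in> ?R"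
      using R(1) by (auto simp: algebra_ideal_def)
    have "a * nu i = nu (a * i) \<and> nu i * a = nu (i * a)" if "a \<in> KR" for a i :: "('a, 'k) salg"
      using that by (simp add: nu_mult nu_id)
    then have "\<forall>a\<in>KR. \<forall>y\<in>nu ` ?R. a * y \<in> nu ` ?R \<and> y * a \<in> nu ` ?R"
      using I(2) by auto
    moreover have "salg.subspace (nu ` ?R)"
    proof (rule salg.subspaceI)
      show "0 \<in> nu ` ?R"
        using nu_0 salg.subspace_0[OF I(1)] by (metis image_eqI)
      show "y + z \<in> nu ` ?R" if "y \<in> nu ` ?R" "z \<in> nu ` ?R" for y z
        using that salg.subspace_add[OF I(1)] by (auto simp flip: nu_add)
      show "c *\<^sub>K y \<in> nu ` ?R" if "y \<in> nu ` ?R" for c y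
        using that salg.subspace_scale[OF I(1)] by (auto simp flip: nu_scale)
    qed
    ultimately have "algebra_ideal KR (nu ` ?R)"
      using nu_KR unfolding algebra_ideal_def by blast
    moreover have "nilpotent (nu ` ?R)"
    proof -
      obtain n where "products ?R n \<subseteq> {0}"
        using R(2) by (auto simp: nilpotent_def)
      then have "products (nu ` ?R) n \<subseteq> {0}"
        using nu_0 by (auto simp flip: products_image_nu)
      then show ?thesis by (auto simp: nilpotent_def)
    qed
    ultimately show "nu x \<in> ?R'"
      using R'(3) \<open>x \<in> ?R\<close> by blast
  }
  {
    let ?P = "{y. nu y \<in> ?R'}"
    assume "nu x \<in> ?R'"
    have I: "salg.subspace ?R'" "\<And>a i. a \<in> KR \<Longrightarrow> i \<in> ?R' \<Longrightarrow> a * i \<in> ?R' \<and> i * a \<in> ?R'"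
      using R'(1) by (auto simp: algebra_ideal_def)
    have "salg.subspace ?P"
      using I(1) by (intro salg.subspaceI)
        (auto simp: nu_0 nu_add nu_scale salg.subspace_0 salg.subspace_add salg.subspace_scale)
    then have "algebra_ideal UNIV ?P"
      using I(2) nu_KR by (auto simp: algebra_ideal_def nu_mult)
    moreover have "nilpotent ?P"
    proof -
      obtain n where n: "products ?R' n \<subseteq> {0}"
        using R'(2) by (auto simp: nilpotent_def)
      obtain m where m: "products {y :: ('a, 'k) salg. nu y = 0} m \<subseteq> {0}"
        using nilpotent_kernel by (auto simp: nilpotent_def)
      have "nu ` products ?P n \<subseteq> products ?R' n"
        unfolding products_image_nu by (rule products_mono) auto
      then have "products ?P n \<subseteq> {y. nu y = 0}"
        using n by auto
      moreover obtain m' where "products ?P m' \<subseteq> products (products ?P n) m"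
        using products_products by blast
      ultimately have "products ?P m' \<subseteq> {0}"
        using m products_mono by blast
      then show ?thesis by (auto simp: nilpotent_def)
    qed
    ultimately show "x \<in> ?R"
      using R(3) \<open>nu x \<in> ?R'\<close> by blast
  }
qed

lemma quotient_iso_nu:
  "\<exists>\<Phi>. quotient_iso UNIV (Rad UNIV) KR (Rad KR) \<Phi> \<and>
      (\<forall>x :: ('a, 'k::field) salg. \<Phi> (coset x (Rad UNIV)) = coset (nu x) (Rad KR))"
proof -
  let ?R = "Rad UNIV :: ('a, 'k) salg set" and ?R' = "Rad KR :: ('a, 'k) salg set"
  have R: "algebra_ideal UNIV ?R" and R': "algebra_ideal KR ?R'"
    by (rule Rad_largest(1)[OF subalgebra_UNIV], rule Rad_largest(1)[OF subalgebra_KR[OF comm]])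
  have sub: "salg.subspace ?R" "salg.subspace ?R'"
    using R R' by (auto simp: algebra_ideal_def)
  define \<Phi> where "\<Phi> X = (\<Union>x\<in>X. coset (nu x) ?R')" for X
  have \<Phi>: "\<Phi> (coset x ?R) = coset (nu x) ?R'" for x
    unfolding \<Phi>_def
  proof (rule UN_coset_const[OF sub(2)])
    show "coset x ?R \<noteq> {}"
      using salg.subspace_0[OF sub(1)] by (auto simp: coset_def)
    show "nu y - nu x \<in> ?R'" if "y \<in> coset x ?R" for y
      using that by (simp add: in_coset_iff Rad_iff_nu flip: nu_diff)
  qed
  have "bij_betw \<Phi> (quotient UNIV ?R) (quotient KR ?R')"
  proof (rule bij_betw_imageI)
    show "inj_on \<Phi> (quotient UNIV ?R)"
    proof (rule inj_onI)
      fix X Y assume "X \<in> quotient UNIV ?R" "Y \<in> quotient UNIV ?R" and eq: "\<Phi> X = \<Phi> Y"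
      then obtain x y where XY: "X = coset x ?R" "Y = coset y ?R"
        by (auto simp: quotient_def)
      have "nu (x - y) \<in> ?R'"
        using eq by (simp add: XY \<Phi> coset_eq_iff[OF sub(2)] nu_diff)
      then show "X = Y"
        by (simp add: XY coset_eq_iff[OF sub(1)] Rad_iff_nu)
    qed
    show "\<Phi> ` quotient UNIV ?R = quotient KR ?R'"
    proof (intro equalityI subsetI)
      fix Y assume "Y \<in> \<Phi> ` quotient UNIV ?R"
      then obtain x where "Y = coset (nu x) ?R'"
        by (auto simp: quotient_def \<Phi>)
      then show "Y \<in> quotient KR ?R'"
        using nu_KR[of x] by (auto simp: quotient_def)
    next
      fix Y assume "Y \<in> quotient KR ?R'"
      then obtain y where y: "y \<in> KR" "Y = coset y ?R'"
        by (auto simp: quotient_def)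
      then have "Y = \<Phi> (coset y ?R)"
        by (simp add: \<Phi> nu_id)
      then show "Y \<in> \<Phi> ` quotient UNIV ?R"
        by (auto simp: quotient_def)
    qed
  qed
  moreover have "\<Phi> (q_add ?R X Y) = q_add ?R' (\<Phi> X) (\<Phi> Y) \<and>
      \<Phi> (q_mult ?R X Y) = q_mult ?R' (\<Phi> X) (\<Phi> Y)"
    if "X \<in> quotient UNIV ?R" "Y \<in> quotient UNIV ?R" for X Y
    using that
    by (auto simp: quotient_def \<Phi> quotient_ops[OF R] quotient_ops[OF R'] nu_KR nu_add nu_mult)
  moreover have "\<Phi> (q_scale ?R c X) = q_scale ?R' c (\<Phi> X)" if "X \<in> quotient UNIV ?R" for c X
    using that
    by (auto simp: quotient_def \<Phi> quotient_ops(3)[OF R _ UNIV_I]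
        quotient_ops(3)[OF R' _ nu_KR] nu_KR nu_scale)
  ultimately show ?thesis
    using \<Phi> by (auto simp: quotient_iso_def)
qed

text \<open>At irregular elements, \<open>single s - nu (single s)\<close> has the same coefficients as
  \<open>single s\<close>, which yields independence.\<close>

lemma basis_kernel_nu:
  defines "B \<equiv> {single s - nu (single s) | s. s \<in> UNIV - Reg} :: ('a, 'k::field) salg set"
  shows "basis_of {x. nu x = 0} B" "card B = card (UNIV - Reg :: 'a set)"
proof -
  let ?b = "\<lambda>s. single s - nu (single s) :: ('a, 'k) salg"
  have B: "B = ?b ` (UNIV - Reg)"
    by (auto simp: B_def)
  have coef_b: "coef (?b s) u = (if u = s then 1 else 0)" if "u \<notin> Reg" for s u
    using that nu_KR[of "single s :: ('a, 'k) salg"] by (simp add: KR_def)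
  have inj: "inj_on ?b (UNIV - Reg)"
  proof (rule inj_onI)
    fix s t assume st: "s \<in> UNIV - Reg" "t \<in> UNIV - Reg" "?b s = ?b t"
    then show "s = t"
      using coef_b[of s s] coef_b[of s t] by (metis DiffD2 zero_neq_one)
  qed
  then show "card B = card (UNIV - Reg :: 'a set)"
    by (simp add: B card_image)
  have "salg.independent B"
  proof (rule salg.independent_if_scalars_zero)
    show "finite B" by (simp add: B)
    fix c x assume 0: "(\<Sum>x\<in>B. c x *\<^sub>K x) = 0" and "x \<in> B"
    then obtain s where s: "s \<notin> Reg" "x = ?b s" by (auto simp: B)
    have "0 = coef (\<Sum>t\<in>UNIV - Reg. c (?b t) *\<^sub>K ?b t) s"
      using 0 by (simp add: B sum.reindex[OF inj])
    also have "\<dots> = (\<Sum>t\<in>UNIV - Reg. c (?b t) * coef (?b t) s)"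
      by (simp only: coef_sum coef_scale)
    also have "\<dots> = (\<Sum>t\<in>UNIV - Reg. if t = s then c (?b s) else 0)"
      using coef_b[OF s(1)] by (intro sum.cong) (simp_all del: coef_add)
    finally show "c x = 0"
      using s by simp
  qed
  moreover have "salg.span B = {x. nu x = 0}"
  proof
    have "B \<subseteq> {x. nu x = 0}"
      by (auto simp: B_def nu_diff nu_id[OF nu_KR])
    moreover have "salg.subspace {x :: ('a, 'k) salg. nu x = 0}"
      by (rule salg.subspaceI) (simp_all add: nu_0 nu_add nu_scale)
    ultimately show "salg.span B \<subseteq> {x. nu x = 0}"
      by (rule salg.span_minimal)
  next
    show "{x. nu x = 0} \<subseteq> salg.span B"
    proof
      fix x :: "('a, 'k) salg" assume "x \<in> {x. nu x = 0}"
      then have "x = x - nu x" by simp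
      also have "\<dots> = (\<Sum>s\<in>UNIV. coef x s *\<^sub>K ?b s)"
        by (simp add: salg.scale_right_diff_distrib sum_subtractf nu_def[of x]
            nu_single flip: salg_expand)
      also have "\<dots> \<in> salg.span B"
      proof (rule salg.span_sum)
        fix s
        show "coef x s *\<^sub>K ?b s \<in> salg.span B"
        proof (cases "s \<in> Reg")
          case True
          then have "?b s = 0"
            by (simp add: nu_single sum_floor_elt_down[OF True])
          then show ?thesis by (simp add: salg.span_zero)
        next
          case False
          then show ?thesis
            by (intro salg.span_scale salg.span_base) (auto simp: B)
        qed
      qed
      finally show "x \<in> salg.span B" .
    qed
  qed
  ultimately show "basis_of {x. nu x = 0} B"
    by (simp add: basis_of_def)
qed

lemma Rad_eq_kernel:
  assumes "CHAR('k::field) = 0 \<or> (\<forall>G :: 'a set. maximal_subgroup G \<longrightarrow> \<not> CHAR('k) dvd card G)"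
  shows "Rad UNIV = {x :: ('a, 'k) salg. nu x = 0}"
proof -
  have "of_nat (card (unit_group e)) \<noteq> (0 :: 'k)" if e: "idempotent e" for e :: 'a
  proof -
    have "e \<in> unit_group e"
      using e idempotent_Reg[OF e] by (simp add: unit_group_eq idempotent_def)
    then have "card (unit_group e) \<noteq> 0"
      by auto
    then show ?thesis
      using assms e by (auto simp: of_nat_eq_0_iff_char_dvd maximal_subgroup_def)
  qed
  then have "Rad KR \<subseteq> {0 :: ('a, 'k) salg}"
    using Rad_largest(1,2)[OF subalgebra_KR[OF comm]] by (intro nilpotent_ideal_KR_trivial)
  moreover have "(0 :: ('a, 'k) salg) \<in> Rad KR"
    using Rad_largest(1)[OF subalgebra_KR[OF comm]]
    unfolding algebra_ideal_def by (intro salg.subspace_0) blast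
  ultimately show ?thesis
    using Rad_iff_nu by auto
qed

end

theorem corollary8p6:
  assumes commuting: "\<And>e f :: 'a::{finite, semigroup_mult}.
      idempotent e \<Longrightarrow> idempotent f \<Longrightarrow> e * f = f * e"
  shows "algebra_hom UNIV KR (nu :: ('a, 'k::field) salg \<Rightarrow> ('a, 'k) salg) \<and>
    (\<forall>x\<in>KR. nu x = (x :: ('a, 'k) salg)) \<and>
    nilpotent {x :: ('a, 'k) salg. nu x = 0} \<and>
    (\<exists>\<Phi>. quotient_iso UNIV (Rad UNIV) KR (Rad KR) \<Phi> \<and>
      (\<forall>x :: ('a, 'k) salg. \<Phi> (coset x (Rad UNIV)) = coset (nu x) (Rad KR))) \<and>
    (CHAR('k) = 0 \<or> (\<forall>G :: 'a set. maximal_subgroup G \<longrightarrow> \<not> CHAR('k) dvd card G) \<longrightarrow>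
      {x :: ('a, 'k) salg. nu x = 0} = Rad UNIV \<and>
      salg.dim (Rad UNIV :: ('a, 'k) salg set) = card (UNIV - Reg :: 'a set) \<and>
      basis_of (Rad UNIV :: ('a, 'k) salg set) {single s - nu (single s) | s. s \<in> UNIV - Reg})"
proof (intro conjI impI)
  show "algebra_hom UNIV KR (nu :: ('a, 'k) salg \<Rightarrow> ('a, 'k) salg)"
    by (simp add: algebra_hom_def nu_KR[OF commuting] nu_scale nu_add nu_mult[OF commuting])
  show "\<forall>x\<in>KR. nu x = (x :: ('a, 'k) salg)"
    using nu_id[OF commuting] by blast
  show "nilpotent {x :: ('a, 'k) salg. nu x = 0}"
    by (rule nilpotent_kernel[OF commuting])
  show "\<exists>\<Phi>. quotient_iso UNIV (Rad UNIV) KR (Rad KR) \<Phi> \<and>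
      (\<forall>x :: ('a, 'k) salg. \<Phi> (coset x (Rad UNIV)) = coset (nu x) (Rad KR))"
    by (rule quotient_iso_nu[OF commuting])
  assume char: "CHAR('k) = 0 \<or> (\<forall>G :: 'a set. maximal_subgroup G \<longrightarrow> \<not> CHAR('k) dvd card G)"
  have Rad: "Rad UNIV = {x :: ('a, 'k) salg. nu x = 0}"
    using char by (intro Rad_eq_kernel commuting)
  let ?B = "{single s - nu (single s) | s. s \<in> UNIV - Reg} :: ('a, 'k) salg set"
  have basis: "basis_of {x. nu x = 0} ?B"
    by (intro basis_kernel_nu(1) commuting)
  have card: "card ?B = card (UNIV - Reg :: 'a set)"
    by (intro basis_kernel_nu(2) commuting)
  show "{x :: ('a, 'k) salg. nu x = 0} = Rad UNIV"
    by (rule Rad[symmetric])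
  show "basis_of (Rad UNIV :: ('a, 'k) salg set) {single s - nu (single s) | s. s \<in> UNIV - Reg}"
    unfolding Rad by (rule basis)
  have "salg.dim (Rad UNIV :: ('a, 'k) salg set) = salg.dim (salg.span ?B)"
    using basis by (simp only: basis_of_def Rad)
  also have "\<dots> = card ?B"
    using basis unfolding basis_of_def by (intro salg.dim_span_eq_card_independent) (rule conjunct1)
  finally show "salg.dim (Rad UNIV :: ('a, 'k) salg set) = card (UNIV - Reg :: 'a set)"
    by (simp only: card)
qed

end
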